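(* Let $n,m,h,r,\lambda$ be positive integers with $n>m>h$, let $V\subseteq V(\lambda K_n^h)$ with $|V|=m$, and let $\mathcal H:=\lambda K_n^h-V$, and let $k:=\frac{\lambda}{r}\binom{n-1}{h-1}$. A given partial $r$-factorization of $\mathcal H$ can be extended to a connected $r$-factorization of $\lambda K_n^h$ if and only if (i) $(n,r,\lambda)$ is $h$-admissible; (ii) $r\ge2$; (iii) each color class of $\mathcal H$ is $r$-regular; (iv) no component of any color class of $\mathcal H$ is $h$-uniform; (v) for $j=1,\dots,k$, $|E(\mathcal H(j))|\le rn/h$; (vi) for $j=1,\dots,k$, $$c(\mathcal H(j))\le rn\Big(1-\frac1h\Big)-\sum_{i\in[h-1]} i\,e_j^{i+1}-m+1,$$ where $e_j^t$ is the number of edges of size $t$ in $\mathcal H(j)$ for $t\in[h]$.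
   Context: $\lambda K_n^h$: $n$ vertices, every $h$-subset an edge of multiplicity $\lambda$. $\mathcal H=\lambda K_n^h-V$ has vertex set $V(\lambda K_n^h)\setminus V$ and edge multiset $\{e\setminus V: e\in E(\lambda K_n^h),\ e\not\subseteq V\}$ (so edges of $\mathcal H$ have sizes $1,\dots,h$; each edge $e\not\subseteq V$ of $\lambda K_n^h$ corresponds to the edge $e\setminus V$ of $\mathcal H$, a bijection of multisets). A partial $r$-factorization of $\mathcal H$ is a coloring of its edges with colors from $[k]$ such that each vertex has degree at most $r$ in every color class $\mathcal H(j)$ (spanning sub-hypergraph of edges of color $j$; $c(\cdot)$ counts its components). An $r$-factor is a spanning sub-hypergraph with all degrees $r$. The partial $r$-factorization extends to a connected $r$-factorization of $\lambda K_n^h$ if there is a coloring of all edges of $\lambda K_n^h$ with colors from $[k]$ in which every edge $e\not\subseteq V$ gets the color of its corresponding edge $e\setminus V$ of $\mathcal H$ and every color class is a connected $r$-factor. A hypergraph is $h$-uniform if all its edges have size $h$. $(n,r,\lambda)$ is $h$-admissible if $h\mid rn$ and $r\mid\lambda\binom{n-1}{h-1}$. *)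

theory Defs
  imports Complex_Main "HOL-Library.Multiset"
begin

record 'a hypergraph =
  verts :: "'a set"
  edges :: "'a set multiset"

definition complete_hypergraph :: "nat \<Rightarrow> nat \<Rightarrow> 'a set \<Rightarrow> 'a hypergraph" where
  "complete_hypergraph lam h X =
     \<lparr>verts = X, edges = repeat_mset lam (mset_set {e. e \<subseteq> X \<and> card e = h})\<rparr>"

definition delete_vertices :: "'a hypergraph \<Rightarrow> 'a set \<Rightarrow> 'a hypergraph" where
  "delete_vertices G V =
     \<lparr>verts = verts G - V,
      edges = {# e - V. e \<in># {# e \<in># edges G. \<not> e \<subseteq> V #} #}\<rparr>"

definition degree :: "'a hypergraph \<Rightarrow> 'a \<Rightarrow> nat" where
  "degree H v = size {# e \<in># edges H. v \<in> e #}"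

definition regular :: "nat \<Rightarrow> 'a hypergraph \<Rightarrow> bool" where
  "regular r H \<longleftrightarrow> (\<forall>v \<in> verts H. degree H v = r)"

definition uniform :: "nat \<Rightarrow> 'a hypergraph \<Rightarrow> bool" where
  "uniform h H \<longleftrightarrow> (\<forall>e \<in># edges H. card e = h)"

definition num_edges_of_size :: "'a hypergraph \<Rightarrow> nat \<Rightarrow> nat" where
  "num_edges_of_size H t = size {# e \<in># edges H. card e = t #}"

definition is_factor :: "nat \<Rightarrow> 'a hypergraph \<Rightarrow> 'a hypergraph \<Rightarrow> bool" where
  "is_factor r F G \<longleftrightarrow> verts F = verts G \<and> edges F \<subseteq># edges G \<and> regular r F"

definition linked :: "'a hypergraph \<Rightarrow> ('a \<times> 'a) set" where
  "linked H = {(u, v). u \<in> verts H \<and> v \<in> verts H \<and>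
                (u, v) \<in> {(x, y). \<exists>e \<in># edges H. x \<in> e \<and> y \<in> e}\<^sup>*}"

text \<open>An isolated vertex forms a component without edges.\<close>

definition components :: "'a hypergraph \<Rightarrow> 'a hypergraph set" where
  "components H =
     (\<lambda>C. \<lparr>verts = C, edges = {# e \<in># edges H. e \<subseteq> C #}\<rparr>) ` (verts H // linked H)"

definition num_components :: "'a hypergraph \<Rightarrow> nat" where
  "num_components H = card (components H)"

definition connected_hypergraph :: "'a hypergraph \<Rightarrow> bool" where
  "connected_hypergraph H \<longleftrightarrow> num_components H = 1"

text \<open>The colours are the integers in \<open>[1,k]\<close>; \<open>k\<close> is a real number because it arises as
  a quotient whose integrality is one of the conditions of the theorem.\<close>

definition colours :: "real \<Rightarrow> nat set" where
  "colours k = {j. 1 \<le> j \<and> real j \<le> k}"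

text \<open>Edges form a multiset, so a colouring assigns a colour to every copy of every edge: it is
  a multiset of pairs (edge, colour) whose projection to the first component is the edge
  multiset. Copies of the same edge may receive different colours and are otherwise
  indistinguishable.\<close>

definition edge_colouring :: "real \<Rightarrow> 'a hypergraph \<Rightarrow> ('a set \<times> nat) multiset \<Rightarrow> bool" where
  "edge_colouring k H c \<longleftrightarrow> image_mset fst c = edges H \<and> (\<forall>x \<in># c. snd x \<in> colours k)"

definition colour_class ::
    "'a hypergraph \<Rightarrow> ('a set \<times> nat) multiset \<Rightarrow> nat \<Rightarrow> 'a hypergraph" where
  "colour_class H c j = \<lparr>verts = verts H, edges = image_mset fst {# x \<in># c. snd x = j #}\<rparr>"

definition partial_factorization ::
    "nat \<Rightarrow> real \<Rightarrow> 'a hypergraph \<Rightarrow> ('a set \<times> nat) multiset \<Rightarrow> bool" where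
  "partial_factorization r k H c \<longleftrightarrow> edge_colouring k H c \<and>
     (\<forall>j \<in> colours k. \<forall>v \<in> verts H. degree (colour_class H c j) v \<le> r)"

definition connected_factorization ::
    "nat \<Rightarrow> real \<Rightarrow> 'a hypergraph \<Rightarrow> ('a set \<times> nat) multiset \<Rightarrow> bool" where
  "connected_factorization r k G d \<longleftrightarrow> edge_colouring k G d \<and>
     (\<forall>j \<in> colours k. is_factor r (colour_class G d j) G \<and>
                      connected_hypergraph (colour_class G d j))"

text \<open>The colouring \<open>d\<close> of \<open>G\<close> extends the colouring \<open>c\<close> of \<open>G - V\<close>: replacing every edge
  \<open>e\<close> not contained in \<open>V\<close> by \<open>e - V\<close>, with its colour kept, turns \<open>d\<close> into \<open>c\<close>. As the
  edges of \<open>G - V\<close> form a multiset, edges of \<open>G\<close> with the same trace outside \<open>V\<close> correspond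
  to indistinguishable copies of one edge of \<open>G - V\<close>.\<close>

definition extends_colouring ::
    "'a set \<Rightarrow> ('a set \<times> nat) multiset \<Rightarrow> ('a set \<times> nat) multiset \<Rightarrow> bool" where
  "extends_colouring V d c \<longleftrightarrow>
     image_mset (\<lambda>(e, j). (e - V, j)) {# (e, j) \<in># d. \<not> e \<subseteq> V #} = c"

definition admissible :: "nat \<Rightarrow> nat \<Rightarrow> nat \<Rightarrow> nat \<Rightarrow> bool" where
  "admissible h n r lam \<longleftrightarrow> h dvd r * n \<and> r dvd lam * ((n - 1) choose (h - 1))"

end

theory Submission
  imports Defs
begin

text \<open>Necessity is double counting; for (vi), contract each component of \<open>H(j)\<close> to a point and use
  that a connected hypergraph on \<open>N\<close> points satisfies \<open>N - 1 \<le> \<Sum>(|e| - 1)\<close>.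

  For sufficiency, amalgamate \<open>V\<close> to a single vertex \<open>\<alpha>\<close>, colour the edges concentrated on \<open>\<alpha>\<close> so
  that every colour gets \<open>rn/h\<close> edges, and split the vertices of \<open>V\<close> off \<open>\<alpha>\<close> one at a time. If \<open>\<alpha>\<close>
  still represents \<open>p\<close> vertices, an edge on which \<open>\<alpha>\<close> has multiplicity \<open>i\<close> is moved to the new
  vertex with weight \<open>i/p\<close>; rounding these weights to 0 and 1 within two laminar families keeps all
  degrees and all edge multiplicities correct. Connectivity survives because of the invariant that
  a colour class minus \<open>\<alpha>\<close> has at most \<open>(r - 1)p + 1\<close> components, each attached to \<open>\<alpha>\<close>: condition
  (vi) is this invariant for \<open>p = m\<close>, condition (iv) the attachment, and the laminar family of
  the colour classes contains the components and suitable unions of them.\<close>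

section \<open>Rounding within two laminar families\<close>

text \<open>One splitting step must meet two kinds of demand. Each colour gives exactly r edges to
  the new vertex, spread over enough components, and each class of edges with equal trace outside
  \<alpha> gives a prescribed number. Each kind fits into one laminar family. Exactness is possible
  because the weights are already integral where needed: rp/p = r for a colour, and \<lambda> C(p,i)
  i/p = \<lambda> C(p-1,i-1) for a trace.

  The number (r-1)p + 1 comes from counting backwards. A new vertex of degree r merges at most r
  components, so their number falls by at most r-1 per step, and it has to be 1 at p = 0.

  The obstacle is waste. A component heavy on \<alpha> may absorb several of the r chosen edges, so
  that fewer components merge; and if all merged components meet \<alpha> only once, the result is
  cut off from \<alpha>. Floors and ceilings for single components do not exclude this: many light
  components could all be rounded down. A bound for a union of components is needed, and its choice
  depends on whether some component has weight at least p.\<close>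

lemma nontrivial_kernel:
  fixes a :: "'i \<Rightarrow> 'e \<Rightarrow> real"
  assumes "finite N" "finite F" "card N < card F"
  shows "\<exists>d. (\<exists>e\<in>F. d e \<noteq> 0) \<and> (\<forall>e. e \<notin> F \<longrightarrow> d e = 0) \<and> (\<forall>i\<in>N. (\<Sum>e\<in>F. a i e * d e) = 0)"
  using assms
proof (induction N arbitrary: F a rule: finite_induct)
  case empty
  then obtain e where "e \<in> F" by fastforce
  then show ?case by (intro exI[of _ "\<lambda>e'. if e' = e then 1 else 0"]) auto
next
  case (insert i N)
  show ?case
  proof (cases "\<forall>e\<in>F. a i e = 0")
    case True
    have "card N < card F" using insert by simp
    from insert.IH[OF insert.prems(1) this, of a] True show ?thesis by auto
  next
    case False
    then obtain e0 where e0: "e0 \<in> F" "a i e0 \<noteq> 0" by blast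
    define F' where "F' = F - {e0}"
    have F: "F = insert e0 F'" "e0 \<notin> F'" "finite F'" using e0 insert.prems by (auto simp: F'_def)
    have "card N < card F'" using insert F by simp
    \<comment> \<open>Gaussian elimination: equation \<open>i\<close> is solved for the pivot
      \<open>e0\<close> and substituted into the others, which changes the coefficients.\<close>
    from insert.IH[OF F(3) this, of "\<lambda>n e. a n e - a n e0 * a i e / a i e0"]
    obtain d where d: "\<exists>e\<in>F'. d e \<noteq> 0" "\<forall>e. e \<notin> F' \<longrightarrow> d e = 0"
      "\<forall>n\<in>N. (\<Sum>e\<in>F'. (a n e - a n e0 * a i e / a i e0) * d e) = 0" by blast
    define s where "s = (\<Sum>e\<in>F'. a i e * d e)"
    define d' where "d' = d(e0 := - s / a i e0)"
    have sum: "(\<Sum>e\<in>F. a n e * d' e) = (\<Sum>e\<in>F'. a n e * d e) - a n e0 * s / a i e0" for n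
    proof -
      have "(\<Sum>e\<in>F'. a n e * d' e) = (\<Sum>e\<in>F'. a n e * d e)"
        using F(2) by (intro sum.cong) (auto simp: d'_def)
      then show ?thesis using F by (simp add: d'_def)
    qed
    have "(\<Sum>e\<in>F. a n e * d' e) = 0" if "n \<in> N" for n
    proof -
      have "0 = (\<Sum>e\<in>F'. a n e * d e - a n e0 / a i e0 * (a i e * d e))"
        using d(3) that by (simp add: left_diff_distrib mult.assoc)
      also have "\<dots> = (\<Sum>e\<in>F'. a n e * d e) - a n e0 / a i e0 * s"
        unfolding s_def sum_subtractf sum_distrib_left ..
      finally show ?thesis using sum by simp
    qed
    moreover have "(\<Sum>e\<in>F. a i e * d' e) = 0" using sum[of i] e0 by (simp add: s_def)
    moreover have "\<exists>e\<in>F. d' e \<noteq> 0" "\<forall>e. e \<notin> F \<longrightarrow> d' e = 0"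
      using d F by (auto simp: d'_def)
    ultimately show ?thesis by blast
  qed
qed

section \<open>Laminar families and integral sums\<close>

definition laminar :: "'e set set \<Rightarrow> bool" where
  "laminar A \<longleftrightarrow> (\<forall>P\<in>A. \<forall>Q\<in>A. P \<inter> Q = {} \<or> P \<subseteq> Q \<or> Q \<subseteq> P)"

lemma laminarD: "laminar A \<Longrightarrow> P \<in> A \<Longrightarrow> Q \<in> A \<Longrightarrow> P \<inter> Q = {} \<or> P \<subseteq> Q \<or> Q \<subseteq> P"
  by (simp add: laminar_def)

lemma laminar_subset: "laminar A \<Longrightarrow> B \<subseteq> A \<Longrightarrow> laminar B"
  by (auto simp: laminar_def)

lemma laminar_insert_superset: "laminar A \<Longrightarrow> A \<subseteq> Pow E \<Longrightarrow> laminar (insert E A)"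
  by (auto simp: laminar_def)

lemma laminar_Un_singletons:
  assumes "laminar A"
  shows "laminar (A \<union> (\<lambda>e. {e}) ` E)"
proof -
  have "{e} \<inter> Q = {} \<or> {e} \<subseteq> Q" "Q \<inter> {e} = {} \<or> {e} \<subseteq> Q" for e and Q :: "'a set"
    by auto
  then show ?thesis using assms unfolding laminar_def ball_Un ball_simps by (intro conjI ballI) simp_all
qed

text \<open>The union is the disjoint union of the maximal members. Once one of them is split off,
  every other member lies inside it or avoids it.\<close>

lemma laminar_sum_Union_Ints:
  fixes x :: "'e \<Rightarrow> real"
  assumes "finite A" "laminar A" "\<And>P. P \<in> A \<Longrightarrow> finite P \<and> sum x P \<in> \<int>"
  shows "sum x (\<Union>A) \<in> \<int>"
  using assms
proof (induction "card A" arbitrary: A rule: less_induct)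
  case less
  show ?case
  proof (cases "A = {}")
    case False
    then obtain M where M: "M \<in> A" "\<And>P. P \<in> A \<Longrightarrow> M \<subseteq> P \<Longrightarrow> P = M"
      using finite_has_maximal[OF less.prems(1)] by metis
    \<comment> \<open>The conjunct \<open>P \<noteq> M\<close> matters for empty \<open>M\<close>,
      which is disjoint from itself; without it \<open>A'\<close> would not be smaller.\<close>
    define A' where "A' = {P \<in> A. P \<inter> M = {} \<and> P \<noteq> M}"
    have "A' \<subset> A" using M by (auto simp: A'_def)
    then have "sum x (\<Union>A') \<in> \<int>"
      using less.prems laminar_subset[of A A']
      by (intro less.hyps) (auto simp: psubset_card_mono finite_subset A'_def)
    moreover have un: "\<Union>A = M \<union> \<Union>A'"
    proof -
      have "P \<subseteq> M \<union> \<Union>A'" if "P \<in> A" for P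
      proof (cases "P \<inter> M = {}")
        case True
        then show ?thesis using that by (cases "P = M") (auto simp: A'_def)
      next
        case False
        then have "P \<subseteq> M \<or> M \<subseteq> P" using laminarD[OF less.prems(2) that M(1)] by blast
        then show ?thesis using M(2) that by blast
      qed
      then show ?thesis using M(1) by (auto simp: A'_def)
    qed
    moreover have "sum x (M \<union> \<Union>A') = sum x M + sum x (\<Union>A')"
      using less.prems M(1) by (intro sum.union_disjoint) (auto simp: A'_def)
    ultimately show ?thesis using less.prems(3)[OF M(1)] by simp
  qed simp
qed

text \<open>The elements of the least member of the family containing \<open>e\<close> that lie in no smaller
  member have an integral sum, so \<open>e\<close> cannot be the only fractional one among them.\<close>
lemma laminar_fractional_twin:
  fixes x :: "'e \<Rightarrow> real"
  assumes "finite A" "laminar A" "\<And>P. P \<in> A \<Longrightarrow> finite P \<and> sum x P \<in> \<int>"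
    and "E \<in> A" "e \<in> E" "x e \<notin> \<int>"
  shows "\<exists>e'. e' \<noteq> e \<and> x e' \<notin> \<int> \<and> (\<forall>P\<in>A. e \<in> P \<longleftrightarrow> e' \<in> P)"
proof -
  have "finite {P \<in> A. e \<in> P}" "{P \<in> A. e \<in> P} \<noteq> {}" using assms by auto
  then obtain Q where Q: "Q \<in> A" "e \<in> Q" "\<And>P. P \<in> A \<Longrightarrow> e \<in> P \<Longrightarrow> P \<subseteq> Q \<Longrightarrow> P = Q"
    using finite_has_minimal[of "{P \<in> A. e \<in> P}"] by blast
  have least: "Q \<subseteq> P" if "P \<in> A" "e \<in> P" for P
    using laminarD[OF assms(2) that(1) Q(1)] Q that by blast
  define M where "M = {P \<in> A. P \<subseteq> Q \<and> e \<notin> P}"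
  have "sum x (\<Union>M) \<in> \<int>" using assms laminar_subset[of A M]
    by (intro laminar_sum_Union_Ints) (auto simp: M_def)
  moreover have "finite Q" "sum x Q \<in> \<int>" "\<Union>M \<subseteq> Q" using assms Q by (auto simp: M_def)
  moreover have "sum x (Q - \<Union>M) = sum x Q - sum x (\<Union>M)"
    using \<open>finite Q\<close> \<open>\<Union>M \<subseteq> Q\<close> by (intro sum_diff) auto
  ultimately have int: "sum x (Q - \<Union>M) \<in> \<int>" by simp
  have "e \<in> Q - \<Union>M" using Q by (auto simp: M_def)
  then have "sum x (Q - \<Union>M) = x e + sum x (Q - \<Union>M - {e})"
    using \<open>finite Q\<close> by (intro sum.remove) auto
  with int assms(6) have "sum x (Q - \<Union>M - {e}) \<notin> \<int>"
    by (metis Ints_diff add_diff_cancel_right')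
  then obtain e' where e': "e' \<in> Q - \<Union>M - {e}" "x e' \<notin> \<int>" by (meson Ints_sum)
  have "e \<in> P \<longleftrightarrow> e' \<in> P" if "P \<in> A" for P
  proof
    assume "e' \<in> P"
    then have "P \<inter> Q \<noteq> {}" using e' by auto
    then have "P \<subseteq> Q \<or> Q \<subseteq> P" using laminarD[OF assms(2) that Q(1)] by blast
    then show "e \<in> P" using that e' \<open>e' \<in> P\<close> Q(2) by (auto simp: M_def)
  qed (use least that e' in auto)
  with e' show ?thesis by auto
qed

text \<open>No fibre is a singleton. This bounds the classes of one family by half the number of
  fractional elements, so two families together pose at most \<open>card F\<close>
  equations.\<close>

lemma twice_card_image_le:
  assumes "finite F" "\<And>e. e \<in> F \<Longrightarrow> \<exists>e'\<in>F. e' \<noteq> e \<and> f e' = f e"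
  shows "2 * card (f ` F) \<le> card F"
proof -
  have "2 \<le> card {e \<in> F. f e = y}" if y: "y \<in> f ` F" for y
  proof -
    obtain e where "e \<in> F" "f e = y" using y by blast
    moreover then obtain e' where "e' \<in> F" "e' \<noteq> e" "f e' = y" using assms(2) by blast
    ultimately have "card {e, e'} = 2" "{e, e'} \<subseteq> {e \<in> F. f e = y}" by auto
    then show ?thesis using assms(1) card_mono[of "{e \<in> F. f e = y}" "{e, e'}"] by simp
  qed
  then have "(\<Sum>y\<in>f ` F. 2) \<le> (\<Sum>y\<in>f ` F. card {e \<in> F. f e = y})" by (intro sum_mono)
  also have "\<dots> = card F" using sum.image_gen[OF assms(1), of "\<lambda>_. 1::nat" f] by simp
  finally show ?thesis by simp
qed

text \<open>Inside \<open>F\<close>, a set that does not separate elements with the same value of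
  \<open>f\<close> is a union of fibres. This passes from the equations of the linear system, one
  per fibre, to the tight sets.\<close>

lemma sum_zero_if_fibre_sums_zero:
  fixes d :: "'e \<Rightarrow> real"
  assumes "finite F" "P \<subseteq> E" "\<And>e. e \<in> E - F \<Longrightarrow> d e = 0" "finite E"
    and "\<And>e e'. e \<in> F \<Longrightarrow> e' \<in> F \<Longrightarrow> f e = f e' \<Longrightarrow> e \<in> P \<Longrightarrow> e' \<in> P"
    and "\<And>y. y \<in> f ` F \<Longrightarrow> sum d {e \<in> F. f e = y} = 0"
  shows "sum d P = 0"
proof -
  have "sum d P = sum d (P \<inter> F)" using assms finite_subset by (intro sum.mono_neutral_right) auto
  also have "\<dots> = (\<Sum>y\<in>f ` (P \<inter> F). sum d {e \<in> P \<inter> F. f e = y})"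
    using assms by (intro sum.image_gen) auto
  also have "\<dots> = (\<Sum>y\<in>f ` (P \<inter> F). sum d {e \<in> F. f e = y})"
  proof (intro sum.cong refl arg_cong[of _ _ "sum d"])
    fix y assume "y \<in> f ` (P \<inter> F)"
    then obtain e where "e \<in> F" "e \<in> P" "y = f e" by auto
    then show "{e \<in> P \<inter> F. f e = y} = {e \<in> F. f e = y}" using assms(5)[of e] by auto
  qed
  also have "\<dots> = 0" using assms(6) by (intro sum.neutral) auto
  finally show ?thesis .
qed

text \<open>Every fractional element shares its class of tight sets with another one, in \<open>A\<close> as well as
  in \<open>B\<close>, so there are at most \<open>card F\<close> classes; one of the constraints is redundant because both
  families of classes partition \<open>F\<close>.\<close>
lemma laminar_tight_direction:
  fixes x :: "'e \<Rightarrow> real"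
  assumes "finite E" "A \<subseteq> Pow E" "B \<subseteq> Pow E" "laminar A" "laminar B" "E \<in> A" "E \<in> B"
    and tight: "\<And>P. P \<in> A \<union> B \<Longrightarrow> sum x P \<in> \<int>"
    and F: "F = {e \<in> E. x e \<notin> \<int>}" "F \<noteq> {}"
  shows "\<exists>d. (\<exists>e\<in>F. d e \<noteq> (0::real)) \<and> (\<forall>e. e \<notin> F \<longrightarrow> d e = 0) \<and> (\<forall>P\<in>A \<union> B. sum d P = 0)"
proof -
  have fin: "finite A" "finite B" "finite F"
    using assms(1) finite_subset[OF assms(2)] finite_subset[OF assms(3)] by (auto simp: F(1))
  define f :: "'e set set \<Rightarrow> 'e \<Rightarrow> 'e set set" where "f = (\<lambda>C e. {P \<in> C. e \<in> P})"
  have cls: "2 * card (f C ` F) \<le> card F" if "C = A \<or> C = B" for C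
  proof (rule twice_card_image_le[OF fin(3)])
    fix e assume "e \<in> F"
    have "\<exists>e'. e' \<noteq> e \<and> x e' \<notin> \<int> \<and> (\<forall>P\<in>C. e \<in> P \<longleftrightarrow> e' \<in> P)"
    proof (rule laminar_fractional_twin)
      show "finite P \<and> sum x P \<in> \<int>" if "P \<in> C" for P
        using that \<open>C = A \<or> C = B\<close> assms finite_subset[of P E] by auto
      show "finite C" "laminar C" "E \<in> C" using fin assms that by auto
    qed (use \<open>e \<in> F\<close> F in auto)
    then show "\<exists>e'\<in>F. e' \<noteq> e \<and> f C e' = f C e"
      using \<open>e \<in> F\<close> F that assms(6,7) by (auto simp: f_def)
  qed
  obtain e0 where e0: "e0 \<in> F" using F by auto
  define g0 where "g0 = f B e0"
  \<comment> \<open>\<open>Inl\<close> and \<open>Inr\<close> keep the classes of the two families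
    apart. Omitting \<open>g0\<close> makes the system strictly smaller than \<open>card F\<close>;
    its equation is recovered from the total over \<open>F\<close>.\<close>
  define N where "N = Inl ` f A ` F \<union> Inr ` (f B ` F - {g0})"
  have "card N \<le> card (f A ` F) + card (f B ` F - {g0})"
    unfolding N_def by (rule order.trans[OF card_Un_le]) (intro add_mono card_image_le; use fin in simp)
  also have "\<dots> < card (f A ` F) + card (f B ` F)"
    using e0 fin by (intro add_strict_left_mono psubset_card_mono) (auto simp: g0_def)
  also have "\<dots> \<le> card F" using cls[of A] cls[of B] by simp
  finally have "card N < card F" .
  moreover have "finite N" using fin by (simp add: N_def)
  ultimately have "\<exists>d. (\<exists>e\<in>F. d e \<noteq> (0::real)) \<and> (\<forall>e. e \<notin> F \<longrightarrow> d e = 0) \<and> (\<forall>i\<in>N.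
    (\<Sum>e\<in>F. (case i of Inl y \<Rightarrow> of_bool (f A e = y) | Inr y \<Rightarrow> of_bool (f B e = y)) * d e) = 0)"
    using fin(3) by (intro nontrivial_kernel)
  then obtain d where d:
"\<exists>e\<in>F. d e \<noteq> (0::real)" "\<forall>e. e \<notin> F \<longrightarrow> d e = 0"
    "\<forall>i\<in>N. (\<Sum>e\<in>F. (case i of Inl y \<Rightarrow> of_bool (f A e = y) | Inr y \<Rightarrow> of_bool (f B e = y)) * d e) = 0"
    by blast
  have sel: "sum d {e \<in> F. f C e = y} = (\<Sum>e\<in>F. of_bool (f C e = y) * d e)" for C y
    using fin by (simp add: of_bool_def if_distrib if_distribR sum.If_cases Int_def cong: if_cong)
  have dA: "sum d {e \<in> F. f A e = y} = 0" if "y \<in> f A ` F" for y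
  proof -
    have "Inl y \<in> N" using that by (simp add: N_def)
    then show ?thesis using d(3) unfolding sel by fastforce
  qed
  have dB': "sum d {e \<in> F. f B e = y} = 0" if "y \<in> f B ` F" "y \<noteq> g0" for y
  proof -
    have "Inr y \<in> N" using that by (simp add: N_def)
    then show ?thesis using d(3) unfolding sel by fastforce
  qed
  have "sum d F = (\<Sum>y\<in>f A ` F. sum d {e \<in> F. f A e = y})" by (rule sum.image_gen[OF fin(3)])
  then have tot: "sum d F = 0" using dA by simp
  have "sum d F = (\<Sum>y\<in>f B ` F. sum d {e \<in> F. f B e = y})" by (rule sum.image_gen[OF fin(3)])
  also have "\<dots> = sum d {e \<in> F. f B e = g0} + (\<Sum>y\<in>f B ` F - {g0}. sum d {e \<in> F. f B e = y})"
    using fin e0 by (intro sum.remove) (auto simp: g0_def)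
  finally have "sum d {e \<in> F. f B e = g0} = 0" using dB' tot by simp
  with dB' have dB: "sum d {e \<in> F. f B e = y} = 0" if "y \<in> f B ` F" for y using that by metis
  have z: "sum d P = 0" if "P \<in> C" "C = A \<or> C = B" for P C
  proof (rule sum_zero_if_fibre_sums_zero[of F P E d "f C"])
    show "P \<subseteq> E" using that assms by auto
    show "e' \<in> P" if "f C e = f C e'" "e \<in> P" for e e'
      using that \<open>P \<in> C\<close> unfolding f_def by blast
    show "sum d {e \<in> F. f C e = y} = 0" if "y \<in> f C ` F" for y
      using that \<open>C = A \<or> C = B\<close> dA dB by auto
  qed (use fin d assms in auto)
  show ?thesis using d z by (intro exI[of _ d]) auto
qed

text \<open>Move \<open>x\<close> along a direction that leaves all integral sums constant until a
  further sum becomes integral. No sum has then passed its floor or ceiling, so the later bounds are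
  nested in the earlier ones, while the number of fractional sums has dropped.\<close>

lemma laminar_rounding_aux:
  fixes x :: "'e \<Rightarrow> real"
  assumes "finite E" "A \<subseteq> Pow E" "B \<subseteq> Pow E" "laminar A" "laminar B" "E \<in> A" "E \<in> B"
    and sing: "\<And>e. e \<in> E \<Longrightarrow> {e} \<in> A"
    and "sum x E \<in> \<int>"
  shows "\<exists>y :: 'e \<Rightarrow> real. \<forall>P\<in>A \<union> B. sum y P \<in> \<int> \<and> of_int \<lfloor>sum x P\<rfloor> \<le> sum y P \<and> sum y P \<le> of_int \<lceil>sum x P\<rceil>"
  using assms(9)
proof (induction "card {P \<in> A \<union> B. sum x P \<notin> \<int>}" arbitrary: x rule: less_induct)
  case less
  have finAB: "finite (A \<union> B)"
    using assms(1) finite_subset[OF assms(2)] finite_subset[OF assms(3)] by auto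
  show ?case
  proof (cases "\<exists>P\<in>A \<union> B. sum x P \<notin> \<int>")
    case False
    then show ?thesis by (intro exI[of _ x] ballI conjI) auto
  next
    case True
    define F where "F = {e \<in> E. x e \<notin> \<int>}"
    from True obtain P0 where P0: "P0 \<in> A \<union> B" "sum x P0 \<notin> \<int>" by blast
    then have "\<exists>e\<in>P0. x e \<notin> \<int>" by (meson Ints_sum)
    then have Fne: "F \<noteq> {}" using P0 assms by (auto simp: F_def)
    have "\<exists>d. (\<exists>e\<in>F. d e \<noteq> (0::real)) \<and> (\<forall>e. e \<notin> F \<longrightarrow> d e = 0) \<and>
        (\<forall>P\<in>{P\<in>A. sum x P \<in> \<int>} \<union> {P\<in>B. sum x P \<in> \<int>}. sum d P = 0)"
      by (rule laminar_tight_direction[where E = E and x = x])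
        (use assms Fne less.prems laminar_subset[of A] laminar_subset[of B] in \<open>auto simp: F_def\<close>)
    then obtain d :: "'e \<Rightarrow> real" where d: "\<exists>e\<in>F. d e \<noteq> 0" "\<And>P. P \<in> A \<union> B \<Longrightarrow> sum x P \<in> \<int> \<Longrightarrow> sum d P = 0"
      by blast
    define D where "D = {P \<in> A \<union> B. sum d P \<noteq> 0}"
    \<comment> \<open>The step length at which the sum over \<open>P\<close> reaches its ceiling if
      it grows along \<open>d\<close>, and its floor if it falls.\<close>
    define t where "t = (\<lambda>P. if sum d P > 0 then (of_int \<lceil>sum x P\<rceil> - sum x P) / sum d P
        else (sum x P - of_int \<lfloor>sum x P\<rfloor>) / - sum d P)"
    have finD: "finite D" using finAB by (simp add: D_def)
    \<comment> \<open>A fractional \<open>e\<close> with nonzero \<open>d e\<close> yields the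
      member \<open>{e}\<close>, so the movement along \<open>d\<close> has to stop.\<close>
    have "D \<noteq> {}" using d(1) sing by (force simp: D_def F_def)
    have tpos: "t P > 0" if "P \<in> D" for P
    proof -
      have "sum x P \<notin> \<int>" "sum d P \<noteq> 0" using that d(2) by (auto simp: D_def)
      moreover have "sum x P < of_int \<lceil>sum x P\<rceil>" "of_int \<lfloor>sum x P\<rfloor> < sum x P"
        using \<open>sum x P \<notin> \<int>\<close>
        by (metis Ints_of_int le_of_int_ceiling order_le_less, metis Ints_of_int of_int_floor_le order_le_less)
      ultimately show ?thesis by (auto simp: t_def divide_neg_neg divide_pos_neg)
    qed
    obtain Q where Q: "Q \<in> D" "\<And>P. P \<in> D \<Longrightarrow> t Q \<le> t P"
      using finD \<open>D \<noteq> {}\<close> by (metis arg_min_if_finite(1) arg_min_least)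
    define z where "z = (\<lambda>e. x e + t Q * d e)"
    have sz: "sum z P = sum x P + t Q * sum d P" for P
      by (simp add: z_def sum.distrib sum_distrib_left)
    have bnd: "of_int \<lfloor>sum x P\<rfloor> \<le> sum z P \<and> sum z P \<le> of_int \<lceil>sum x P\<rceil>" if "P \<in> A \<union> B" for P
    proof (cases "sum d P = 0")
      case True
      then show ?thesis by (simp add: sz)
    next
      case False
      then have "P \<in> D" using that by (simp add: D_def)
      then have le: "t Q \<le> t P" "t Q > 0" using Q tpos by auto
      show ?thesis
      proof (cases "sum d P > 0")
        case True
        then have "t Q * sum d P \<le> of_int \<lceil>sum x P\<rceil> - sum x P" "t Q * sum d P \<ge> 0"
          using le by (auto simp: t_def field_simps)
        then show ?thesis unfolding sz using of_int_floor_le[of "sum x P"] by linarith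
      next
        case neg: False
        then have "t Q * (- sum d P) \<le> sum x P - of_int \<lfloor>sum x P\<rfloor>" "t Q * (- sum d P) \<ge> 0"
          using le False by (auto simp: t_def field_simps mult_nonneg_nonpos2 zero_le_mult_iff)
        then show ?thesis unfolding sz using le_of_int_ceiling[of "sum x P"]
          by (simp only: mult_minus_right) linarith
      qed
    qed
    have keep: "sum z P \<in> \<int>" if "P \<in> A \<union> B" "sum x P \<in> \<int>" for P
      using d(2) that by (simp add: sz)
    have "sum z Q \<in> \<int>" "sum x Q \<notin> \<int>" "Q \<in> A \<union> B"
      using Q(1) d(2)[of Q] by (auto simp: D_def sz t_def)
    then have "{P \<in> A \<union> B. sum z P \<notin> \<int>} \<subset> {P \<in> A \<union> B. sum x P \<notin> \<int>}" using keep by auto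
    then have "card {P \<in> A \<union> B. sum z P \<notin> \<int>} < card {P \<in> A \<union> B. sum x P \<notin> \<int>}"
      using finAB by (intro psubset_card_mono) auto
    from less.hyps[OF this] keep less.prems assms(6) obtain y :: "'e \<Rightarrow> real" where
      y: "\<And>P. P \<in> A \<union> B \<Longrightarrow> sum y P \<in> \<int> \<and> of_int \<lfloor>sum z P\<rfloor> \<le> sum y P \<and> sum y P \<le> of_int \<lceil>sum z P\<rceil>"
      by blast
    have "of_int \<lfloor>sum x P\<rfloor> \<le> sum y P \<and> sum y P \<le> of_int \<lceil>sum x P\<rceil>" if "P \<in> A \<union> B" for P
    proof -
      have "\<lfloor>sum x P\<rfloor> \<le> \<lfloor>sum z P\<rfloor>" "\<lceil>sum z P\<rceil> \<le> \<lceil>sum x P\<rceil>"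
        using bnd[OF that] by (auto simp: le_floor_iff ceiling_le_iff)
      then have "real_of_int \<lfloor>sum x P\<rfloor> \<le> of_int \<lfloor>sum z P\<rfloor>" "real_of_int \<lceil>sum z P\<rceil> \<le> of_int \<lceil>sum x P\<rceil>"
        by auto
      then show ?thesis using y[OF that] by linarith
    qed
    then show ?thesis using y by blast
  qed
qed

text \<open>Adding the singletons confines every coordinate to 0 or 1, which makes the rounded point
  an indicator function. Adding \<open>E\<close> to both families ensures that each element lies in
  some tight member, where it finds its fractional twin.\<close>

theorem laminar_rounding:
  fixes x :: "'e \<Rightarrow> real"
  assumes "finite E" "A \<subseteq> Pow E" "B \<subseteq> Pow E" "laminar A" "laminar B"
    and x: "\<And>e. e \<in> E \<Longrightarrow> 0 \<le> x e \<and> x e \<le> 1" and "sum x E \<in> \<int>"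
  shows "\<exists>S\<subseteq>E. \<forall>P\<in>A \<union> B. \<lfloor>sum x P\<rfloor> \<le> int (card (S \<inter> P)) \<and> int (card (S \<inter> P)) \<le> \<lceil>sum x P\<rceil>"
proof -
  define s where "s = (\<lambda>e::'e. {e}) ` E"
  have lam: "laminar (insert E (A \<union> s))" "laminar (insert E B)"
    using assms(2-5) unfolding s_def
    by (auto intro!: laminar_insert_superset laminar_Un_singletons)
  have "\<exists>y :: 'e \<Rightarrow> real. \<forall>P\<in>insert E (A \<union> s) \<union> insert E B. sum y P \<in> \<int> \<and>
      of_int \<lfloor>sum x P\<rfloor> \<le> sum y P \<and> sum y P \<le> of_int \<lceil>sum x P\<rceil>"
    by (rule laminar_rounding_aux[OF assms(1) _ _ lam]) (use assms in \<open>auto simp: s_def\<close>)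
  then obtain y :: "'e \<Rightarrow> real" where "\<forall>P\<in>insert E (A \<union> s) \<union> insert E B. sum y P \<in> \<int> \<and>
      of_int \<lfloor>sum x P\<rfloor> \<le> sum y P \<and> sum y P \<le> of_int \<lceil>sum x P\<rceil>" ..
  note y = this[rule_format]
  have y01: "y e = 0 \<or> y e = 1" if "e \<in> E" for e
  proof -
    have *: "y e \<in> \<int>" "of_int \<lfloor>x e\<rfloor> \<le> y e" "y e \<le> of_int \<lceil>x e\<rceil>"
      using y[of "{e}"] that by (auto simp: s_def)
    then obtain z where "y e = of_int z" by (auto elim: Ints_cases)
    moreover with * have "\<lfloor>x e\<rfloor> \<le> z" "z \<le> \<lceil>x e\<rceil>" by auto
    moreover have "0 \<le> \<lfloor>x e\<rfloor>" "\<lceil>x e\<rceil> \<le> 1" using x[OF that] by (auto simp: ceiling_le_iff)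
    ultimately have "0 \<le> z" "z \<le> 1" by linarith+
    then have "z = 0 \<or> z = 1" by linarith
    then show ?thesis using \<open>y e = of_int z\<close> by auto
  qed
  define S where "S = {e \<in> E. y e = 1}"
  have "real (card (S \<inter> P)) = sum y P" if "P \<subseteq> E" for P
  proof -
    have "sum y P = (\<Sum>e\<in>P. of_bool (e \<in> S))"
      using that y01 by (intro sum.cong) (auto simp: S_def)
    then show ?thesis using finite_subset[OF that assms(1)] by (simp add: Int_commute)
  qed
  moreover have "P \<subseteq> E" if "P \<in> A \<union> B" for P using that assms(2,3) by auto
  ultimately have "of_int \<lfloor>sum x P\<rfloor> \<le> real (card (S \<inter> P)) \<and> real (card (S \<inter> P)) \<le> of_int \<lceil>sum x P\<rceil>"
    if "P \<in> A \<union> B" for P using that y[of P] by auto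
  then have "\<lfloor>sum x P\<rfloor> \<le> int (card (S \<inter> P)) \<and> int (card (S \<inter> P)) \<le> \<lceil>sum x P\<rceil>"
    if "P \<in> A \<union> B" for P using that by (metis of_int_le_iff of_int_of_nat_eq)
  then show ?thesis by (intro exI[of _ S]) (auto simp: S_def)
qed

section \<open>Splitting an amalgamated vertex\<close>

lemma fibres_refine:
  assumes "\<And>e e'. e \<in> I \<Longrightarrow> e' \<in> I \<Longrightarrow> f e = f e' \<Longrightarrow> g e = g e'"
  shows "{e \<in> I. f e = y} \<inter> {e \<in> I. g e = z} = {} \<or> {e \<in> I. f e = y} \<subseteq> {e \<in> I. g e = z}"
proof (cases "\<exists>e\<in>I. f e = y \<and> g e = z")
  case True
  then obtain e where "e \<in> I" "f e = y" "g e = z" by blast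
  then have "g e' = z" if "e' \<in> I" "f e' = y" for e' using assms[of e' e] that by simp
  then show ?thesis by auto
qed auto

text \<open>Three successively finer partitions are nested. Below they are the colours, a
  bipartition of each colour, and the labels within a colour.\<close>

lemma laminar_fibres:
  assumes "\<And>e e'. e \<in> I \<Longrightarrow> e' \<in> I \<Longrightarrow> f3 e = f3 e' \<Longrightarrow> f2 e = f2 e'"
    and "\<And>e e'. e \<in> I \<Longrightarrow> e' \<in> I \<Longrightarrow> f2 e = f2 e' \<Longrightarrow> f1 e = f1 e'"
  shows "laminar (range (\<lambda>y. {e \<in> I. f1 e = y}) \<union> range (\<lambda>y. {e \<in> I. f2 e = y}) \<union>
    range (\<lambda>y. {e \<in> I. f3 e = y}))"
proof -
  have 31: "f1 e = f1 e'" if "e \<in> I" "e' \<in> I" "f3 e = f3 e'" for e e'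
    using assms that by blast
  have w: "P \<inter> Q = {} \<or> P \<subseteq> Q \<Longrightarrow> P \<inter> Q = {} \<or> P \<subseteq> Q \<or> Q \<subseteq> P"
    "P \<inter> Q = {} \<or> P \<subseteq> Q \<Longrightarrow> Q \<inter> P = {} \<or> Q \<subseteq> P \<or> P \<subseteq> Q" for P Q :: "'a set" by auto
  note r = fibres_refine[of I f3 f2, OF assms(1)] fibres_refine[of I f2 f1, OF assms(2)]
    fibres_refine[of I f3 f1, OF 31] fibres_refine
  show ?thesis unfolding laminar_def ball_Un
    by (intro conjI ballI; elim rangeE; hypsubst; (rule r[THEN w(1)] r[THEN w(2)]; assumption?))
qed

text \<open>The labels stand for components of a colour class on which the remaining amalgamated
  vertex has \<open>w\<close>-weight at least 1. If some label has weight at least \<open>p\<close>, then \<open>T\<close> collects those;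
  otherwise \<open>T\<close> collects the labels of weight at least 2.\<close>
lemma fair_choice_keeps_connectivity:
  fixes w :: "'i \<Rightarrow> nat" and l :: "'i \<Rightarrow> 'l"
  assumes fin: "finite C" and pr: "p > 0" "r > 0" and tot: "sum w C = r * p"
    and pos: "\<And>y. y \<in> l ` C \<Longrightarrow> 1 \<le> sum w {e \<in> C. l e = y}"
    and few: "card (l ` C) \<le> (r - 1) * p + 1"
  shows "\<exists>T. T \<subseteq> C \<and> (\<forall>e\<in>C. \<forall>f\<in>C. l e = l f \<longrightarrow> (e \<in> T \<longleftrightarrow> f \<in> T)) \<and>
    (\<forall>S. card (S \<inter> C) = r \<longrightarrow> sum w T div p \<le> card (S \<inter> T) \<longrightarrow>
      sum w (C - T) div p \<le> card (S \<inter> (C - T)) \<longrightarrow>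
      (\<forall>y\<in>l ` C. sum w {e \<in> C. l e = y} div p \<le> card (S \<inter> {e \<in> C. l e = y}) \<and>
        card (S \<inter> {e \<in> C. l e = y}) \<le> (sum w {e \<in> C. l e = y} + p - 1) div p) \<longrightarrow>
      card (l ` C) \<le> card (l ` (S \<inter> C)) + (r - 1) * (p - 1) \<and>
      (p \<ge> 2 \<longrightarrow> (\<exists>e\<in>C. l e \<in> l ` (S \<inter> C) \<and> of_bool (e \<in> S) < w e)))"
proof -
  define d where "d = (\<lambda>y. sum w {e \<in> C. l e = y})"
  define Big where "Big = {y \<in> l ` C. p \<le> d y}"
  have sum_labels: "sum w {e \<in> C. l e \<in> Y} = sum d Y" if "Y \<subseteq> l ` C" for Y
  proof -
    have im: "l ` {e \<in> C. l e \<in> Y} = Y" using that by auto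
    have "sum w {e \<in> C. l e \<in> Y} = (\<Sum>y\<in>l ` {e \<in> C. l e \<in> Y}. sum w {e \<in> {e \<in> C. l e \<in> Y}. l e = y})"
      using fin by (intro sum.image_gen) auto
    also have "\<dots> = sum d Y" unfolding im d_def by (intro sum.cong refl arg_cong[of _ _ "sum w"]) auto
    finally show ?thesis .
  qed
  \<comment> \<open>An edge keeps multiplicity \<open>w e - of_bool (e \<in> S)\<close> on the
    amalgamated vertex. A touched label that loses less than its whole weight therefore stays
    attached.\<close>
  have leftover: "\<exists>e\<in>C. l e \<in> l ` (S \<inter> C) \<and> of_bool (e \<in> S) < w e"
    if "y \<in> l ` (S \<inter> C)" "card (S \<inter> {e \<in> C. l e = y}) < d y" for S y
  proof (rule ccontr)
    assume "\<not> ?thesis"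
    then have "w e \<le> of_bool (e \<in> S)" if "e \<in> C" "l e = y" for e
      using that \<open>y \<in> l ` (S \<inter> C)\<close> by (metis not_less)
    then have "d y \<le> (\<Sum>e\<in>{e \<in> C. l e = y}. of_bool (e \<in> S))" unfolding d_def by (intro sum_mono) auto
    also have "\<dots> = card (S \<inter> {e \<in> C. l e = y})" using fin by (simp add: Int_commute)
    finally show False using that by simp
  qed
  have inj: "card (l ` (S \<inter> D)) = card (S \<inter> D)"
    if "D \<subseteq> C" "\<And>e. e \<in> D \<Longrightarrow> card (S \<inter> {f \<in> C. l f = l e}) \<le> 1" for S D
  proof (rule card_image, rule inj_onI)
    fix e f assume "e \<in> S \<inter> D" "f \<in> S \<inter> D" "l e = l f"
    then have "{e, f} \<subseteq> S \<inter> {f \<in> C. l f = l e}" using that by auto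
    then have "card {e, f} \<le> card (S \<inter> {f \<in> C. l f = l e})" using fin by (intro card_mono) auto
    also have "\<dots> \<le> 1" using that(2)[of e] \<open>e \<in> S \<inter> D\<close> by simp
    finally have "card {e, f} \<le> 1" .
    then show "e = f" by (cases "e = f") auto
  qed
  \<comment> \<open>A label lighter than \<open>p\<close> has ceiling at most 1, so distinct chosen
    edges in light labels touch distinct labels.\<close>
  have small: "(d y + p - 1) div p \<le> 1" if "d y < p" for y
  proof -
    have "d y + p - 1 < 2 * p" using that by simp
    then have "(d y + p - 1) div p < 2" by (simp add: less_mult_imp_div_less)
    then show ?thesis by simp
  qed
  show ?thesis
  proof (cases "Big = {}")
    case False
    define T where "T = {e \<in> C. l e \<in> Big}"
    have CT: "C - T = {e \<in> C. l e \<in> l ` C - Big}" by (auto simp: T_def)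
    have "card (l ` C - Big) \<le> sum d (l ` C - Big)"
    proof -
      have "(\<Sum>y\<in>l ` C - Big. 1) \<le> sum d (l ` C - Big)"
        using pos by (intro sum_mono) (auto simp: d_def)
      then show ?thesis by simp
    qed
    also have "\<dots> = sum w (C - T)" unfolding CT by (rule sum_labels[symmetric]) auto
    finally have few_small: "card (l ` C - Big) \<le> sum w (C - T)" .
    have "Big \<subseteq> l ` C" by (auto simp: Big_def)
    then have fB: "finite Big" "card (l ` C) = card Big + card (l ` C - Big)"
      using fin by (auto simp: card_Diff_subset finite_subset card_mono)
    have Bpos: "1 \<le> card Big" using False fB by (simp add: Suc_leI card_gt_0_iff)
    have main: "card (l ` C) \<le> card (l ` (S \<inter> C)) + (r - 1) * (p - 1) \<and>
        (p \<ge> 2 \<longrightarrow> (\<exists>e\<in>C. l e \<in> l ` (S \<inter> C) \<and> of_bool (e \<in> S) < w e))"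
      if S: "sum w (C - T) div p \<le> card (S \<inter> (C - T))"
        "\<And>y. y \<in> l ` C \<Longrightarrow> d y div p \<le> card (S \<inter> {e \<in> C. l e = y}) \<and>
          card (S \<inter> {e \<in> C. l e = y}) \<le> (d y + p - 1) div p" for S
    proof
      have touched: "y \<in> l ` (S \<inter> C)" if "y \<in> Big" for y
      proof -
        have "1 \<le> d y div p" using that pr by (auto simp: Big_def Suc_le_eq div_greater_zero_iff)
        then have "card (S \<inter> {e \<in> C. l e = y}) \<noteq> 0" using S(2)[of y] that by (auto simp: Big_def)
        then have "S \<inter> {e \<in> C. l e = y} \<noteq> {}" by (metis card.empty)
        then show ?thesis by auto
      qed
      define s where "s = card (l ` (S \<inter> (C - T)))"
      have "card (S \<inter> {f \<in> C. l f = l e}) \<le> 1" if "e \<in> C - T" for e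
        using S(2)[of "l e"] small[of "l e"] that by (auto simp: T_def Big_def not_le)
      then have "s = card (S \<inter> (C - T))" unfolding s_def by (intro inj) auto
      then have s_ge: "card (l ` C - Big) div p \<le> s"
        using S(1) div_le_mono[OF few_small, of p] by simp
      have "card Big + s = card (Big \<union> l ` (S \<inter> (C - T)))"
        using fB fin unfolding s_def by (intro card_Un_disjoint[symmetric]) (auto simp: T_def)
      also have "\<dots> \<le> card (l ` (S \<inter> C))" using touched fin by (intro card_mono) auto
      finally have s_le: "card Big + s \<le> card (l ` (S \<inter> C))" .
      define q where "q = card (l ` C - Big)"
      have "q \<le> (r - 1) * p" using few fB Bpos by (simp add: q_def)
      \<comment> \<open>With q = ap + b the claim reads a(p-1) + b \<le> (r-1)(p-1). Since q \<le>
        (r-1)p, either a = r-1 and b = 0, or a \<le> r-2 and b \<le> p-1. The bound on q has no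
        summand 1 because a heavy label accounts for it.\<close>
      have "q \<le> q div p + (r - 1) * (p - 1)"
      proof -
        have q: "q = (q div p) * p + q mod p" by simp
        have "q div p \<le> r - 1" using div_le_mono[OF \<open>q \<le> (r - 1) * p\<close>, of p] pr by simp
        have *: "(q div p) * p = q div p + (q div p) * (p - 1)" using pr by (simp add: algebra_simps)
        show ?thesis
        proof (cases "q div p = r - 1")
          case True
          then have "q mod p = 0" using \<open>q \<le> (r - 1) * p\<close> q by (metis add_le_same_cancel1 le_0_eq)
          with q * have "q = q div p + q div p * (p - 1)" by linarith
          then show ?thesis using True by (metis order_refl)
        next
          case False
          then have "Suc (q div p) * (p - 1) \<le> (r - 1) * (p - 1)"
            using \<open>q div p \<le> r - 1\<close> by (intro mult_right_mono) auto
          moreover have "q mod p \<le> p - 1" using pr by (simp add: Suc_leI less_Suc_eq_le[symmetric])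
          ultimately show ?thesis using q * by simp
        qed
      qed
      then show "card (l ` C) \<le> card (l ` (S \<inter> C)) + (r - 1) * (p - 1)"
        using fB s_ge s_le unfolding q_def by linarith
      show "p \<ge> 2 \<longrightarrow> (\<exists>e\<in>C. l e \<in> l ` (S \<inter> C) \<and> of_bool (e \<in> S) < w e)"
      proof
        assume p2: "p \<ge> 2"
        obtain y where y: "y \<in> Big" using False by auto
        then have "p \<le> d y" "y \<in> l ` C" by (auto simp: Big_def)
        \<comment> \<open>Equivalent to (d y - 1)(p - 1) > 0. The ceiling of d y / p is thus below d
          y, and the heavy label keeps contact with the amalgamated vertex.\<close>
        have "d y + p - 1 < d y * p"
        proof -
          have "p * (p - 1) \<le> d y * (p - 1)" using \<open>p \<le> d y\<close> by (intro mult_right_mono) auto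
          moreover have "2 * (p - 1) \<le> p * (p - 1)" using p2 by (intro mult_right_mono) auto
          moreover have "d y * p = d y * (p - 1) + d y" using p2 by (simp add: algebra_simps)
          ultimately show ?thesis using p2 by linarith
        qed
        then have "(d y + p - 1) div p < d y" by (rule less_mult_imp_div_less)
        then show "\<exists>e\<in>C. l e \<in> l ` (S \<inter> C) \<and> of_bool (e \<in> S) < w e"
          using S(2)[OF \<open>y \<in> l ` C\<close>] touched[OF y] by (intro leftover[of y]) auto
      qed
    qed
    show ?thesis
    proof (intro exI[of _ T] conjI allI impI)
      fix S assume "sum w (C - T) div p \<le> card (S \<inter> (C - T))"
        and "\<forall>y\<in>l ` C. sum w {e \<in> C. l e = y} div p \<le> card (S \<inter> {e \<in> C. l e = y}) \<and>
        card (S \<inter> {e \<in> C. l e = y}) \<le> (sum w {e \<in> C. l e = y} + p - 1) div p"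
      then have "card (l ` C) \<le> card (l ` (S \<inter> C)) + (r - 1) * (p - 1) \<and>
        (p \<ge> 2 \<longrightarrow> (\<exists>e\<in>C. l e \<in> l ` (S \<inter> C) \<and> of_bool (e \<in> S) < w e))"
        by (intro main) (auto simp: d_def)
      then show "card (l ` C) \<le> card (l ` (S \<inter> C)) + (r - 1) * (p - 1)"
        "2 \<le> p \<Longrightarrow> \<exists>e\<in>C. l e \<in> l ` (S \<inter> C) \<and> of_bool (e \<in> S) < w e" by auto
    qed (auto simp: T_def)
  next
    case True
    define T where "T = {e \<in> C. l e \<in> {y \<in> l ` C. 2 \<le> d y}}"
    have CT: "C - T = {e \<in> C. l e \<in> {y \<in> l ` C. d y = 1}}"
      using pos by (force simp: T_def d_def)
    have wCT: "sum w (C - T) = card {y \<in> l ` C. d y = 1}"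
      unfolding CT by (subst sum_labels) auto
    have nbig: "d y < p" if "y \<in> l ` C" for y using True that by (auto simp: Big_def not_le)
    have main: "card (l ` C) \<le> card (l ` (S \<inter> C)) + (r - 1) * (p - 1) \<and>
        (p \<ge> 2 \<longrightarrow> (\<exists>e\<in>C. l e \<in> l ` (S \<inter> C) \<and> of_bool (e \<in> S) < w e))"
      if S: "card (S \<inter> C) = r" "sum w T div p \<le> card (S \<inter> T)"
        "\<And>y. y \<in> l ` C \<Longrightarrow> card (S \<inter> {e \<in> C. l e = y}) \<le> (d y + p - 1) div p" for S
    proof
      have le1: "card (S \<inter> {e \<in> C. l e = y}) \<le> 1" if "y \<in> l ` C" for y
        using S(3)[OF that] small[OF nbig[OF that]] by simp
      \<comment> \<open>No label takes two chosen edges, so \<open>r\<close> labels are touched and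
        the bound for \<open>p\<close> becomes the one for \<open>p - 1\<close>.\<close>
      have "card (l ` (S \<inter> C)) = r" using S(1) le1 by (subst inj) auto
      moreover have "(r - 1) * p + 1 = r + (r - 1) * (p - 1)" using pr by (cases p; cases r) auto
      ultimately show "card (l ` C) \<le> card (l ` (S \<inter> C)) + (r - 1) * (p - 1)" using few by simp
      show "p \<ge> 2 \<longrightarrow> (\<exists>e\<in>C. l e \<in> l ` (S \<inter> C) \<and> of_bool (e \<in> S) < w e)"
      proof
        assume p2: "p \<ge> 2"
        \<comment> \<open>Otherwise more than (r-1)p labels have weight 1. These are then all (r-1)p
          + 1 labels, and the total weight rp equals (r-1)p + 1, which forces p = 1.\<close>
        have "p \<le> sum w T"
        proof (rule ccontr)
          assume "\<not> p \<le> sum w T"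
          moreover have "sum w T + sum w (C - T) = r * p"
            using tot fin sum.subset_diff[of T C w] by (auto simp: T_def)
          moreover have "r * p = (r - 1) * p + p" using pr by (cases r) auto
          ultimately have "(r - 1) * p < sum w (C - T)" by linarith
          moreover have le: "card {y \<in> l ` C. d y = 1} \<le> card (l ` C)" using fin by (intro card_mono) auto
          ultimately have *: "sum w (C - T) = (r - 1) * p + 1" "card {y \<in> l ` C. d y = 1} = card (l ` C)"
            using few wCT by linarith+
          then have "{y \<in> l ` C. d y = 1} = l ` C" using fin by (intro card_subset_eq) auto
          then have "C - T = C" unfolding CT by auto
          then show False using * tot \<open>r * p = (r - 1) * p + p\<close> p2 by simp
        qed
        then have "1 \<le> sum w T div p" using pr by (simp add: Suc_le_eq div_greater_zero_iff)
        then have "card (S \<inter> T) \<noteq> 0" using S(2) by simp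
        then have "S \<inter> T \<noteq> {}" by (metis card.empty)
        then obtain e where e: "e \<in> S" "e \<in> T" by auto
        then have "e \<in> C" "2 \<le> d (l e)" by (auto simp: T_def)
        then show "\<exists>e\<in>C. l e \<in> l ` (S \<inter> C) \<and> of_bool (e \<in> S) < w e"
          using le1[of "l e"] e by (intro leftover[of "l e"]) auto
      qed
    qed
    show ?thesis
    proof (intro exI[of _ T] conjI allI impI)
      fix S assume "card (S \<inter> C) = r" "sum w T div p \<le> card (S \<inter> T)"
        and "\<forall>y\<in>l ` C. sum w {e \<in> C. l e = y} div p \<le> card (S \<inter> {e \<in> C. l e = y}) \<and>
        card (S \<inter> {e \<in> C. l e = y}) \<le> (sum w {e \<in> C. l e = y} + p - 1) div p"
      then have "card (l ` C) \<le> card (l ` (S \<inter> C)) + (r - 1) * (p - 1) \<and>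
        (p \<ge> 2 \<longrightarrow> (\<exists>e\<in>C. l e \<in> l ` (S \<inter> C) \<and> of_bool (e \<in> S) < w e))"
        by (intro main) (auto simp: d_def)
      then show "card (l ` C) \<le> card (l ` (S \<inter> C)) + (r - 1) * (p - 1)"
        "2 \<le> p \<Longrightarrow> \<exists>e\<in>C. l e \<in> l ` (S \<inter> C) \<and> of_bool (e \<in> S) < w e" by auto
    qed (auto simp: T_def)
  qed
qed

section \<open>Selecting the edges at a new vertex and splitting it off\<close>

lemma ceiling_divide_of_nat_le: "p > 0 \<Longrightarrow> \<lceil>real m / real p\<rceil> \<le> int ((m + p - 1) div p)"
proof -
  assume p: "p > 0"
  have "m + p - 1 = (m + p - 1) div p * p + (m + p - 1) mod p" by simp
  moreover have "(m + p - 1) mod p < p" using p by simp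
  ultimately have "m \<le> (m + p - 1) div p * p" by linarith
  then have "real m \<le> real ((m + p - 1) div p) * real p" by (metis of_nat_le_iff of_nat_mult)
  then show ?thesis using p by (simp add: ceiling_le_iff pos_divide_le_eq)
qed

text \<open>Edges are indices with fixed colours: parallel edges stay distinct, and only their
  traces change while vertices are split off.\<close>

locale detachment =
  fixes I :: "'i set" and col :: "'i \<Rightarrow> nat" and J :: "nat set" and X :: "'a set"
    and h r lam :: nat
  assumes finite_I: "finite I" and finite_X: "finite X" and col_J: "col ` I \<subseteq> J" and r_pos: "r > 0"
begin

text \<open>Adjacency of edges through vertices of their traces only. Its reflexive transitive
  closure therefore describes components after deletion of the amalgamated vertex.\<close>

definition meet :: "('i \<Rightarrow> 'a set) \<Rightarrow> nat \<Rightarrow> ('i \<times> 'i) set" where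
  "meet A j = {(e, f). e \<in> I \<and> f \<in> I \<and> col e = j \<and> col f = j \<and> A e \<inter> A f \<noteq> {}}"

text \<open>The vertices in \<open>U\<close> are amalgamated to a single one, on which \<open>e\<close> has multiplicity
  \<open>h - card (A e)\<close>. Edges with the same colour and label lie in one component of the colour class
  after deletion of the amalgamated vertex; an edge concentrated on that vertex counts as a
  component of its own. For \<open>U = {}\<close> the bound on the number of labels says that every colour
  class is connected.\<close>
definition amalgam :: "'a set \<Rightarrow> ('i \<Rightarrow> 'a set) \<Rightarrow> ('i \<Rightarrow> 'l) \<Rightarrow> bool" where
  "amalgam U A l \<longleftrightarrow> U \<subseteq> X \<and>
     (\<forall>e\<in>I. A e \<subseteq> X - U \<and> card (A e) \<le> h) \<and>
     (\<forall>B. B \<subseteq> X - U \<longrightarrow> card B \<le> h \<longrightarrow>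
        card {e \<in> I. A e = B} = lam * (card U choose (h - card B))) \<and>
     (\<forall>j\<in>J. (\<Sum>e\<in>{e \<in> I. col e = j}. h - card (A e)) = r * card U) \<and>
     (\<forall>j\<in>J. \<forall>v\<in>X - U. card {e \<in> I. col e = j \<and> v \<in> A e} = r) \<and>
     (\<forall>j\<in>J. card (l ` {e \<in> I. col e = j}) \<le> (r - 1) * card U + 1) \<and>
     (\<forall>e\<in>I. \<forall>f\<in>I. col e = col f \<longrightarrow> l e = l f \<longrightarrow> (e, f) \<in> (meet A (col e))\<^sup>*) \<and>
     (U \<noteq> {} \<longrightarrow> (\<forall>e\<in>I. \<exists>f\<in>I. col f = col e \<and> l f = l e \<and> card (A f) < h))"

lemma amalgamD:
  assumes "amalgam U A l"
  shows "U \<subseteq> X"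
    and "e \<in> I \<Longrightarrow> A e \<subseteq> X - U"
    and "e \<in> I \<Longrightarrow> card (A e) \<le> h"
    and "B \<subseteq> X - U \<Longrightarrow> card B \<le> h \<Longrightarrow> card {e \<in> I. A e = B} = lam * (card U choose (h - card B))"
    and "j \<in> J \<Longrightarrow> (\<Sum>e\<in>{e \<in> I. col e = j}. h - card (A e)) = r * card U"
    and "j \<in> J \<Longrightarrow> v \<in> X - U \<Longrightarrow> card {e \<in> I. col e = j \<and> v \<in> A e} = r"
    and "j \<in> J \<Longrightarrow> card (l ` {e \<in> I. col e = j}) \<le> (r - 1) * card U + 1"
    and "e \<in> I \<Longrightarrow> f \<in> I \<Longrightarrow> col e = col f \<Longrightarrow> l e = l f \<Longrightarrow> (e, f) \<in> (meet A (col e))\<^sup>*"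
    and "U \<noteq> {} \<Longrightarrow> e \<in> I \<Longrightarrow> \<exists>f\<in>I. col f = col e \<and> l f = l e \<and> card (A f) < h"
  using assms unfolding amalgam_def by meson+

text \<open>The edges with the trace of \<open>e\<close> number \<lambda> C(|U|, h - |A e|), which
  is nonzero because \<open>e\<close> is one of them. The bound keeps the weights to be rounded at
  most 1.\<close>

lemma amalgam_mult_le:
  assumes "amalgam U A l" "e \<in> I"
  shows "h - card (A e) \<le> card U"
proof (rule ccontr)
  assume "\<not> ?thesis"
  then have "card {f \<in> I. A f = A e} = 0"
    using assms by (simp add: amalgam_def binomial_eq_0)
  then show False using assms(2) finite_I by auto
qed

text \<open>\<open>S\<close> consists of the edges that will contain the next vertex. The weights (h
  - |A e|)/p are rounded; colours and trace classes have integral totals and are met exactly, labels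
  and their unions up to floor and ceiling.\<close>

lemma fair_selection:
  fixes l :: "'i \<Rightarrow> 'l"
  assumes am: "amalgam U A l" and U: "U \<noteq> {}"
  defines "p \<equiv> card U"
  obtains S where "S \<subseteq> I"
    and "\<And>B. B \<subseteq> X - U \<Longrightarrow> card B \<le> h \<Longrightarrow>
      card {e \<in> S. A e = B} * p = card {e \<in> I. A e = B} * (h - card B)"
    and "\<And>j. j \<in> J \<Longrightarrow> card {e \<in> S. col e = j} = r"
    and "\<And>j. j \<in> J \<Longrightarrow>
      card (l ` {e \<in> I. col e = j}) \<le> card (l ` {e \<in> S. col e = j}) + (r - 1) * (p - 1)"
    and "\<And>j. j \<in> J \<Longrightarrow> p \<ge> 2 \<Longrightarrow>
      \<exists>e\<in>I. col e = j \<and> l e \<in> l ` {e \<in> S. col e = j} \<and> of_bool (e \<in> S) < h - card (A e)"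
proof -
  define w where "w = (\<lambda>e. h - card (A e))"
  define C where "C = (\<lambda>j. {e \<in> I. col e = j})"
  have "finite U" using am finite_X finite_subset by (auto simp: amalgam_def)
  then have p: "p > 0" using U by (simp add: p_def card_gt_0_iff)
  have finC: "finite (C j)" for j using finite_I by (simp add: C_def)
  have totC: "sum w (C j) = r * p" if "j \<in> J" for j
    using amalgamD(5)[OF am that] unfolding C_def w_def p_def .
  define good where "good = (\<lambda>j T. T \<subseteq> C j \<and> (\<forall>e\<in>C j. \<forall>f\<in>C j. l e = l f \<longrightarrow> (e \<in> T \<longleftrightarrow> f \<in> T)) \<and>
    (\<forall>S. card (S \<inter> C j) = r \<longrightarrow> sum w T div p \<le> card (S \<inter> T) \<longrightarrow>
      sum w (C j - T) div p \<le> card (S \<inter> (C j - T)) \<longrightarrow>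
      (\<forall>y\<in>l ` C j. sum w {e \<in> C j. l e = y} div p \<le> card (S \<inter> {e \<in> C j. l e = y}) \<and>
        card (S \<inter> {e \<in> C j. l e = y}) \<le> (sum w {e \<in> C j. l e = y} + p - 1) div p) \<longrightarrow>
      card (l ` C j) \<le> card (l ` (S \<inter> C j)) + (r - 1) * (p - 1) \<and>
      (p \<ge> 2 \<longrightarrow> (\<exists>e\<in>C j. l e \<in> l ` (S \<inter> C j) \<and> of_bool (e \<in> S) < w e))))"
  have "\<exists>T. good j T" if j: "j \<in> J" for j
    unfolding good_def
  proof (rule fair_choice_keeps_connectivity[OF finC p r_pos totC[OF j]])
    show "1 \<le> sum w {e \<in> C j. l e = y}" if y: "y \<in> l ` C j" for y
    proof -
      obtain e where "e \<in> I" "col e = j" "l e = y" using y by (auto simp: C_def)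
      then obtain f where f: "f \<in> {e \<in> C j. l e = y}" "card (A f) < h"
        using amalgamD(9)[OF am U, of e] unfolding C_def by auto
      then have "1 \<le> w f" by (simp add: w_def)
      also have "w f \<le> sum w {e \<in> C j. l e = y}" using f finC by (intro member_le_sum) auto
      finally show ?thesis .
    qed
    show "card (l ` C j) \<le> (r - 1) * p + 1"
      using amalgamD(7)[OF am j] unfolding C_def p_def .
  qed
  then obtain T where T: "good j (T j)" if "j \<in> J" for j by metis
  have T_labels: "\<forall>e\<in>C j. \<forall>f\<in>C j. l e = l f \<longrightarrow> (e \<in> T j \<longleftrightarrow> f \<in> T j)" if "j \<in> J" for j
    using T[OF that] unfolding good_def by (elim conjE)
  define f1 where "f1 = col"
  define f2 where "f2 = (\<lambda>e. (col e, e \<in> T (col e)))"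
  define f3 where "f3 = (\<lambda>e. (col e, l e))"
  define AF where "AF = range (\<lambda>y. {e \<in> I. f1 e = y}) \<union> range (\<lambda>y. {e \<in> I. f2 e = y}) \<union>
    range (\<lambda>y. {e \<in> I. f3 e = y})"
  define BF where "BF = range (\<lambda>B. {e \<in> I. A e = B})"
  define x where "x = (\<lambda>e. real (w e) / real p)"
  have sx: "sum x P = real (sum w P) / real p" for P
    by (simp add: x_def sum_divide_distrib)
  have lamAF: "laminar AF" unfolding AF_def
  proof (rule laminar_fibres)
    fix e e' assume e: "e \<in> I" "e' \<in> I"
    show "f1 e = f1 e'" if "f2 e = f2 e'" using that by (simp add: f1_def f2_def)
    show "f2 e = f2 e'" if "f3 e = f3 e'"
    proof -
      have "col e \<in> J" "e \<in> C (col e)" "e' \<in> C (col e)" "l e = l e'" "col e = col e'"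
        using e that col_J by (auto simp: f3_def C_def)
      then have "e \<in> T (col e) \<longleftrightarrow> e' \<in> T (col e)" by (blast dest: T_labels[rule_format])
      then show ?thesis using \<open>col e = col e'\<close> by (simp add: f2_def)
    qed
  qed
  \<comment> \<open>A single partition is the case of three equal partitions.\<close>
  have "laminar (BF \<union> BF \<union> BF)" unfolding BF_def by (rule laminar_fibres)
  then have lamBF: "laminar BF" by simp
  have sub: "AF \<subseteq> Pow I" "BF \<subseteq> Pow I" by (auto simp: AF_def BF_def)
  have x01: "0 \<le> x e \<and> x e \<le> 1" if "e \<in> I" for e
    using amalgam_mult_le[OF am that] p by (simp add: x_def w_def p_def)
  have xI: "sum x I \<in> \<int>"
  proof -
    have "sum w I = (\<Sum>j\<in>col ` I. sum w (C j))"
      using sum.image_gen[OF finite_I, of w col] by (simp add: C_def)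
    also have "\<dots> = (\<Sum>j\<in>col ` I. r * p)" using totC col_J by (intro sum.cong) auto
    finally have "sum w I = card (col ` I) * r * p" by simp
    then have "sum x I = real (card (col ` I) * r)" using p by (simp add: sx)
    then show ?thesis by simp
  qed
  have "\<exists>S\<subseteq>I. \<forall>P\<in>AF \<union> BF.
      \<lfloor>sum x P\<rfloor> \<le> int (card (S \<inter> P)) \<and> int (card (S \<inter> P)) \<le> \<lceil>sum x P\<rceil>"
    by (rule laminar_rounding[OF finite_I sub lamAF lamBF x01 xI])
  then obtain S where S: "S \<subseteq> I"
    "\<And>P. P \<in> AF \<union> BF \<Longrightarrow> \<lfloor>sum x P\<rfloor> \<le> int (card (S \<inter> P)) \<and> int (card (S \<inter> P)) \<le> \<lceil>sum x P\<rceil>"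
    by meson
  have rnd: "sum w P div p \<le> card (S \<inter> P) \<and> card (S \<inter> P) \<le> (sum w P + p - 1) div p"
    if "P \<in> AF \<union> BF" for P
  proof -
    have "int (sum w P div p) \<le> int (card (S \<inter> P))"
      using S(2)[OF that] unfolding sx by (metis floor_divide_of_nat_eq of_int_of_nat_eq)
    moreover have "int (card (S \<inter> P)) \<le> int ((sum w P + p - 1) div p)"
      using S(2)[OF that] ceiling_divide_of_nat_le[OF p, of "sum w P"] unfolding sx by linarith
    ultimately show ?thesis by simp
  qed
  have exact: "card (S \<inter> P) = t" if "P \<in> AF \<union> BF" "sum w P = t * p" for P t
  proof -
    have "t * p + p - 1 = p - 1 + t * p" using p by simp
    also have "\<dots> div p = t" using p by (simp only: div_mult_self1) simp
    finally have "(t * p + p - 1) div p = t" .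
    then show ?thesis using rnd[OF that(1)] that(2) p by simp
  qed
  have colC: "card (S \<inter> C j) = r" if "j \<in> J" for j
    by (rule exact) (use totC[OF that] in \<open>auto simp: AF_def C_def f1_def\<close>)
  have SC: "S \<inter> C j = {e \<in> S. col e = j}" for j using S(1) by (auto simp: C_def)
  have conn: "card (l ` C j) \<le> card (l ` (S \<inter> C j)) + (r - 1) * (p - 1) \<and>
      (p \<ge> 2 \<longrightarrow> (\<exists>e\<in>C j. l e \<in> l ` (S \<inter> C j) \<and> of_bool (e \<in> S) < w e))" if j: "j \<in> J" for j
  proof -
    have "T j \<subseteq> C j" using T[OF j] unfolding good_def by blast
    then have "T j = {e \<in> I. f2 e = (j, True)}" "C j - T j = {e \<in> I. f2 e = (j, False)}"
      by (auto simp: f2_def C_def)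
    then have "T j \<in> AF \<union> BF" "C j - T j \<in> AF \<union> BF" unfolding AF_def by blast+
    moreover have "{e \<in> C j. l e = y} \<in> AF \<union> BF" for y
    proof -
      have "{e \<in> C j. l e = y} = {e \<in> I. f3 e = (j, y)}" by (auto simp: f3_def C_def)
      then show ?thesis unfolding AF_def by blast
    qed
    ultimately have "sum w (T j) div p \<le> card (S \<inter> T j)"
      "sum w (C j - T j) div p \<le> card (S \<inter> (C j - T j))"
      "\<forall>y\<in>l ` C j. sum w {e \<in> C j. l e = y} div p \<le> card (S \<inter> {e \<in> C j. l e = y}) \<and>
        card (S \<inter> {e \<in> C j. l e = y}) \<le> (sum w {e \<in> C j. l e = y} + p - 1) div p"
      using rnd by auto
    then show ?thesis using T[OF j] colC[OF j] unfolding good_def by simp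
  qed
  show thesis
  proof (rule that[OF S(1)])
    fix B assume B: "B \<subseteq> X - U" "card B \<le> h"
    have "sum w {e \<in> I. A e = B} = card {e \<in> I. A e = B} * (h - card B)"
      by (simp add: w_def)
    \<comment> \<open>By i C(p,i) = p C(p-1,i-1) with i = h - |B|. For i = 0 truncated subtraction
      would turn the right-hand binomial into 1, hence the separate case of weight 0.\<close>
    moreover have "card {e \<in> I. A e = B} * (h - card B) = lam * ((p - 1) choose (h - card B - 1)) * p
        \<or> h - card B = 0"
      using amalgamD(4)[OF am B] times_binomial_minus1_eq[of "h - card B" p]
      by (cases "card B < h") (simp_all add: p_def mult.assoc mult.left_commute mult.commute)
    ultimately obtain t where t: "sum w {e \<in> I. A e = B} = t * p"
      "card {e \<in> I. A e = B} * (h - card B) = t * p" by (metis mult_0 mult_0_right)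
    have "card (S \<inter> {e \<in> I. A e = B}) = t"
      by (rule exact) (use t(1) in \<open>auto simp: BF_def\<close>)
    moreover have "S \<inter> {e \<in> I. A e = B} = {e \<in> S. A e = B}" using S(1) by auto
    ultimately show "card {e \<in> S. A e = B} * p = card {e \<in> I. A e = B} * (h - card B)"
      using t by simp
  next
    fix j assume j: "j \<in> J"
    show "card {e \<in> S. col e = j} = r" using colC[OF j] SC by simp
    show "card (l ` {e \<in> I. col e = j}) \<le> card (l ` {e \<in> S. col e = j}) + (r - 1) * (p - 1)"
      using conn[OF j] unfolding SC by (simp add: C_def)
    show "\<exists>e\<in>I. col e = j \<and> l e \<in> l ` {e \<in> S. col e = j} \<and> of_bool (e \<in> S) < h - card (A e)"
      if "p \<ge> 2" using conn[OF j] that unfolding SC by (auto simp: C_def w_def)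
  qed
qed

text \<open>The selected edges receive \<open>u\<close>, and the labels they touch become one
  because \<open>u\<close> joins their components. The selection is such that this merging yields
  the bound for \<open>card U - 1\<close> and leaves the merged component attached as long as
  vertices remain amalgamated.\<close>

lemma detach_vertex:
  fixes l :: "'i \<Rightarrow> 'l"
  assumes am: "amalgam U A l" and u: "u \<in> U"
  shows "\<exists>A' (l' :: 'i \<Rightarrow> 'l). amalgam (U - {u}) A' l' \<and> (\<forall>e\<in>I. A' e - {u} = A e)"
proof -
  define p where "p = card U"
  have UX: "U \<subseteq> X" using am by (simp add: amalgam_def)
  then have finU: "finite U" using finite_X finite_subset by auto
  then have p: "p > 0" "card (U - {u}) = p - 1" using u by (auto simp: p_def card_gt_0_iff)
  have "U \<noteq> {}" using u by auto
  obtain S where S: "S \<subseteq> I"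
    and types: "\<And>B. B \<subseteq> X - U \<Longrightarrow> card B \<le> h \<Longrightarrow>
      card {e \<in> S. A e = B} * p = card {e \<in> I. A e = B} * (h - card B)"
    and deg: "\<And>j. j \<in> J \<Longrightarrow> card {e \<in> S. col e = j} = r"
    and few: "\<And>j. j \<in> J \<Longrightarrow>
      card (l ` {e \<in> I. col e = j}) \<le> card (l ` {e \<in> S. col e = j}) + (r - 1) * (p - 1)"
    and left: "\<And>j. j \<in> J \<Longrightarrow> p \<ge> 2 \<Longrightarrow>
      \<exists>e\<in>I. col e = j \<and> l e \<in> l ` {e \<in> S. col e = j} \<and> of_bool (e \<in> S) < h - card (A e)"
    using fair_selection[OF am \<open>U \<noteq> {}\<close>] unfolding p_def by blast
  have finS: "finite S" using S finite_I finite_subset by auto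
  have AX: "A e \<subseteq> X - U" "card (A e) \<le> h" "finite (A e)" "u \<notin> A e" if "e \<in> I" for e
    using amalgamD(2,3)[OF am that] u finite_X finite_subset[of "A e" X] by auto
  have num: "card {e \<in> I. A e = B} = lam * (p choose (h - card B))" if "B \<subseteq> X - U" "card B \<le> h" for B
    using amalgamD(4)[OF am that] unfolding p_def .
  have numS: "card {e \<in> S. A e = B} = lam * ((p - 1) choose (h - card B - 1))"
    if "B \<subseteq> X - U" "card B < h" for B
  proof -
    have "card {e \<in> S. A e = B} * p = lam * ((h - card B) * (p choose (h - card B)))"
      using types num that by (simp add: mult.assoc mult.commute)
    also have "\<dots> = lam * ((p - 1) choose (h - card B - 1)) * p"
      using times_binomial_minus1_eq[of "h - card B" p] that by simp
    finally show ?thesis using p by simp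
  qed
  \<comment> \<open>Edges whose trace already has size \<open>h\<close> have weight 0 and are never
    selected.\<close>
  have numS0: "{e \<in> S. A e = B} = {}" if "B \<subseteq> X - U" "card B = h" for B
  proof -
    have "card {e \<in> S. A e = B} = 0" using types[OF that(1)] that(2) p by simp
    then show ?thesis using finS by simp
  qed
  have lt: "card (A e) < h" if "e \<in> S" for e
    using numS0[of "A e"] AX[of e] that S by (metis (mono_tags, lifting) empty_iff le_neq_implies_less mem_Collect_eq subsetD)
  define A' where "A' = (\<lambda>e. if e \<in> S then insert u (A e) else A e)"
  define Sj where "Sj = (\<lambda>j. {e \<in> S. col e = j})"
  \<comment> \<open>The merged component takes the label of an arbitrary selected edge, which exists
    since \<open>r\<close> is positive.\<close>
  define rep where "rep = (\<lambda>j. SOME e. e \<in> Sj j)"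
  define l' where "l' = (\<lambda>e. if l e \<in> l ` Sj (col e) then l (rep (col e)) else l e)"
  have rep: "rep j \<in> Sj j" if "j \<in> J" for j
  proof -
    have "Sj j \<noteq> {}" using deg[OF that] r_pos by (metis Sj_def card.empty less_numeral_extra(3))
    then show ?thesis unfolding rep_def by (simp add: some_in_eq)
  qed
  have cardA': "card (A' e) = card (A e) + of_bool (e \<in> S)" if "e \<in> I" for e
    using AX[OF that] by (simp add: A'_def)
  have diffA': "A' e - {u} = A e" if "e \<in> I" for e using AX[OF that] by (auto simp: A'_def)
  have J: "col e \<in> J" if "e \<in> I" for e using that col_J by auto
  have uX: "u \<in> X" using u UX by auto

  have c1: "\<forall>e\<in>I. A' e \<subseteq> X - (U - {u}) \<and> card (A' e) \<le> h"
  proof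
    fix e assume e: "e \<in> I"
    have "card (A' e) \<le> h" using cardA'[OF e] lt[of e] AX(2)[OF e] by (cases "e \<in> S") auto
    then show "A' e \<subseteq> X - (U - {u}) \<and> card (A' e) \<le> h" using AX[OF e] uX by (auto simp: A'_def)
  qed
  \<comment> \<open>Pascal's rule: traces containing \<open>u\<close> come from selected edges,
    traces avoiding \<open>u\<close> from the others.\<close>
  have c2: "card {e \<in> I. A' e = B} = lam * (p - 1 choose (h - card B))"
    if B: "B \<subseteq> X - (U - {u})" "card B \<le> h" for B
  proof (cases "u \<in> B")
    case True
    have fB: "finite B" using B finite_X finite_subset by auto
    have "A' e = B \<longleftrightarrow> e \<in> S \<and> A e = B - {u}" if "e \<in> I" for e
      using AX[OF that] True by (auto simp: A'_def)
    then have "{e \<in> I. A' e = B} = {e \<in> S. A e = B - {u}}" using S by auto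
    moreover have "card B = card (B - {u}) + 1" using card.remove[OF fB True] by simp
    ultimately show ?thesis using numS[of "B - {u}"] B by auto
  next
    case False
    have BU: "B \<subseteq> X - U" using B False by auto
    have "A' e = B \<longleftrightarrow> e \<notin> S \<and> A e = B" if "e \<in> I" for e
      using AX[OF that] False by (auto simp: A'_def)
    then have "{e \<in> I. A' e = B} = {e \<in> I. A e = B} - {e \<in> S. A e = B}" by auto
    moreover have "{e \<in> S. A e = B} \<subseteq> {e \<in> I. A e = B}" using S by auto
    ultimately have *: "card {e \<in> I. A' e = B} = card {e \<in> I. A e = B} - card {e \<in> S. A e = B}"
      using finS by (simp add: card_Diff_subset)
    show ?thesis
    proof (cases "card B = h")
      case True
      then show ?thesis using * num[OF BU] numS0[OF BU] by simp
    next
      case False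
      then have "card B < h" using B by simp
      moreover then have "p choose (h - card B) = (p - 1 choose (h - card B - 1)) + (p - 1 choose (h - card B))"
        using p by (intro choose_reduce_nat) auto
      ultimately show ?thesis using * num[OF BU] numS[OF BU] by (simp add: distrib_left)
    qed
  qed
  have c3: "(\<Sum>e\<in>{e \<in> I. col e = j}. h - card (A' e)) = r * (p - 1)" if j: "j \<in> J" for j
  proof -
    have "h - card (A' e) + of_bool (e \<in> S) = h - card (A e)" if "e \<in> I" for e
      using cardA'[OF that] lt[of e] by (cases "e \<in> S") auto
    then have "(\<Sum>e\<in>{e \<in> I. col e = j}. h - card (A' e) + of_bool (e \<in> S)) =
        (\<Sum>e\<in>{e \<in> I. col e = j}. h - card (A e))" by (intro sum.cong) auto
    also have "\<dots> = r * p" using amalgamD(5)[OF am j] unfolding p_def .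
    finally have "(\<Sum>e\<in>{e \<in> I. col e = j}. h - card (A' e)) + card ({e \<in> I. col e = j} \<inter> S) = r * p"
      using finite_I by (simp add: sum.distrib)
    moreover have "{e \<in> I. col e = j} \<inter> S = {e \<in> S. col e = j}" using S by auto
    ultimately show ?thesis using deg[OF j] p by (simp add: diff_mult_distrib2)
  qed
  have c4: "card {e \<in> I. col e = j \<and> v \<in> A' e} = r" if j: "j \<in> J" and v: "v \<in> X - (U - {u})" for j v
  proof (cases "v = u")
    case True
    have "{e \<in> I. col e = j \<and> u \<in> A' e} = {e \<in> S. col e = j}"
      using S AX(4) by (auto simp: A'_def split: if_splits)
    then show ?thesis using True deg[OF j] by simp
  next
    case False
    then have "{e \<in> I. col e = j \<and> v \<in> A' e} = {e \<in> I. col e = j \<and> v \<in> A e}"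
      by (auto simp: A'_def split: if_splits)
    moreover have "v \<in> X - U" using v False by auto
    ultimately show ?thesis using amalgamD(6)[OF am j] by simp
  qed
  \<comment> \<open>The touched labels collapse to one: the old number minus the touched labels plus
    1.\<close>
  have c5: "card (l' ` {e \<in> I. col e = j}) \<le> (r - 1) * (p - 1) + 1" if j: "j \<in> J" for j
  proof -
    let ?C = "{e \<in> I. col e = j}"
    have sub: "l ` Sj j \<subseteq> l ` ?C" using S by (auto simp: Sj_def)
    have "l' ` ?C \<subseteq> insert (l (rep j)) (l ` ?C - l ` Sj j)"
      by (auto simp: l'_def)
    then have "card (l' ` ?C) \<le> card (insert (l (rep j)) (l ` ?C - l ` Sj j))"
      using finite_I by (intro card_mono) auto
    also have "\<dots> \<le> card (l ` ?C - l ` Sj j) + 1"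
      by (simp add: card_insert_le_m1 card_insert_if finite_I)
    also have "card (l ` ?C - l ` Sj j) = card (l ` ?C) - card (l ` Sj j)"
      using sub finite_I by (intro card_Diff_subset) (auto intro: finite_subset[OF sub])
    finally show ?thesis using few[OF j] unfolding Sj_def by linarith
  qed
  have lift: "(e, f) \<in> (meet A' (col e))\<^sup>*" if "e \<in> I" "f \<in> I" "col e = col f" "l e = l f" for e f
  proof -
    have "(e, f) \<in> (meet A (col e))\<^sup>*" using amalgamD(8)[OF am that] .
    moreover have "meet A (col e) \<subseteq> meet A' (col e)" by (auto simp: meet_def A'_def)
    ultimately show ?thesis using rtrancl_mono by blast
  qed
  \<comment> \<open>Two edges with the merged label reach selected edges along old paths, and the
    selected edges meet in \<open>u\<close>.\<close>
  have c6: "(e, f) \<in> (meet A' (col e))\<^sup>*" if e: "e \<in> I" "f \<in> I" "col e = col f" "l' e = l' f" for e f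
  proof (cases "l e \<in> l ` Sj (col e)")
    case True
    have "l f \<in> l ` Sj (col e)"
    proof (rule ccontr)
      assume "l f \<notin> l ` Sj (col e)"
      then have "l (rep (col e)) = l f" using e True by (simp add: l'_def)
      then show False using \<open>l f \<notin> l ` Sj (col e)\<close> rep[OF J[OF e(1)]] by (metis imageI)
    qed
    then obtain e' f' where *: "e' \<in> S" "col e' = col e" "l e = l e'" "f' \<in> S" "col f' = col e" "l f = l f'"
      using True by (auto simp: Sj_def)
    then have "(e, e') \<in> (meet A' (col e))\<^sup>*" "(f', f) \<in> (meet A' (col e))\<^sup>*"
      using lift[of e e'] lift[of f' f] e S by auto
    moreover have "(e', f') \<in> meet A' (col e)" using * S by (auto simp: meet_def A'_def)
    ultimately show ?thesis by (meson converse_rtrancl_into_rtrancl rtrancl_trans)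
  next
    case False
    have "l f \<notin> l ` Sj (col e)"
    proof
      assume "l f \<in> l ` Sj (col e)"
      then have "l (rep (col e)) = l e" using e False by (simp add: l'_def)
      then show False using False rep[OF J[OF e(1)]] by (metis imageI)
    qed
    then show ?thesis using False e lift by (simp add: l'_def)
  qed
  \<comment> \<open>Since \<open>p \<ge> 2\<close>, some edge of the merged component keeps
    multiplicity on the amalgamated vertex. Any other label contains no selected edge and is
    unchanged.\<close>
  have c7: "\<exists>f\<in>I. col f = col e \<and> l' f = l' e \<and> card (A' f) < h" if ne: "U - {u} \<noteq> {}" and e: "e \<in> I" for e
  proof (cases "l e \<in> l ` Sj (col e)")
    case True
    have "card (U - {u}) \<noteq> 0" using ne finU by simp
    then have "2 \<le> p" using p by simp
    then obtain g where g: "g \<in> I" "col g = col e" "l g \<in> l ` Sj (col e)" "of_bool (g \<in> S) < h - card (A g)"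
      using left[OF J[OF e]] unfolding Sj_def by blast
    then have "card (A' g) < h" using cardA'[OF g(1)] by simp
    then show ?thesis using g True by (auto simp: l'_def)
  next
    case False
    obtain f where f: "f \<in> I" "col f = col e" "l f = l e" "card (A f) < h"
      using amalgamD(9)[OF am \<open>U \<noteq> {}\<close> e] by blast
    then have "f \<notin> S" using False by (auto simp: Sj_def image_iff)
    then have "A' f = A f" "l' f = l' e" using f by (auto simp: A'_def l'_def)
    then show ?thesis using f by auto
  qed
  have "amalgam (U - {u}) A' l'"
    unfolding amalgam_def p(2) by (intro conjI ballI allI impI; (fact | use UX c1 c2 c3 c4 c5 c6 c7 in blast))
  then show ?thesis using diffA' by blast
qed

theorem detach_all:
  fixes l :: "'i \<Rightarrow> 'l"
  assumes "amalgam U A l"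
  shows "\<exists>A' (l' :: 'i \<Rightarrow> 'l). amalgam {} A' l' \<and> (\<forall>e\<in>I. A' e - U = A e)"
proof -
  have "finite U" using assms finite_X finite_subset by (auto simp: amalgam_def)
  then show ?thesis using assms
  proof (induction U arbitrary: A l rule: finite_induct)
    case empty
    then show ?case by auto
  next
    case (insert u U)
    obtain A1 and l1 :: "'i \<Rightarrow> 'l" where 1: "amalgam U A1 l1" "\<forall>e\<in>I. A1 e - {u} = A e"
      using detach_vertex[OF insert.prems, of u] insert.hyps by auto
    obtain A2 and l2 :: "'i \<Rightarrow> 'l" where 2: "amalgam {} A2 l2" "\<forall>e\<in>I. A2 e - U = A1 e"
      using insert.IH[OF 1(1)] by auto
    have "A2 e - insert u U = A e" if "e \<in> I" for e
      using 1(2) 2(2) that by (metis Diff_insert)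
    then show ?case using 2(1) by auto
  qed
qed

end

section \<open>Components and degrees of hypergraphs\<close>

abbreviation adj :: "'a hypergraph \<Rightarrow> ('a \<times> 'a) set" where
  "adj H \<equiv> {(x, y). \<exists>e\<in>#edges H. x \<in> e \<and> y \<in> e}"

lemma equiv_linked: "equiv (verts H) (linked H)"
proof -
  have "sym ((adj H)\<^sup>*)" by (rule sym_rtrancl) (auto simp: sym_def)
  then show ?thesis
    by (intro equivI) (auto simp: linked_def refl_on_def sym_def trans_def)
qed

lemma num_components_eq: "num_components H = card (verts H // linked H)"
  unfolding num_components_def components_def by (rule card_image) (auto intro: inj_onI)

lemma linked_edge: "e \<in># edges H \<Longrightarrow> e \<subseteq> verts H \<Longrightarrow> x \<in> e \<Longrightarrow> y \<in> e \<Longrightarrow> (x, y) \<in> linked H"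
  unfolding linked_def by (auto intro!: r_into_rtrancl)

lemma connected_hypergraph_iff:
  "connected_hypergraph H \<longleftrightarrow> verts H \<noteq> {} \<and> (\<forall>u\<in>verts H. \<forall>v\<in>verts H. (u, v) \<in> (adj H)\<^sup>*)"
proof
  assume "connected_hypergraph H"
  then obtain Q where Q: "verts H // linked H = {Q}"
    by (auto simp: connected_hypergraph_def num_components_eq card_1_singleton_iff)
  have "linked H `` {u} = Q" if "u \<in> verts H" for u using Q quotientI[OF that, of "linked H"] by simp
  then have "(u, v) \<in> linked H" if "u \<in> verts H" "v \<in> verts H" for u v
    using that eq_equiv_class[OF _ equiv_linked] by metis
  then show "verts H \<noteq> {} \<and> (\<forall>u\<in>verts H. \<forall>v\<in>verts H. (u, v) \<in> (adj H)\<^sup>*)"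
    using Q by (auto simp: linked_def)
next
  assume *: "verts H \<noteq> {} \<and> (\<forall>u\<in>verts H. \<forall>v\<in>verts H. (u, v) \<in> (adj H)\<^sup>*)"
  then have "linked H `` {u} = verts H" if "u \<in> verts H" for u
    using that by (auto simp: linked_def)
  then have "verts H // linked H = {verts H}" using * by (auto simp: quotient_def)
  then show "connected_hypergraph H" by (simp add: connected_hypergraph_def num_components_eq)
qed

lemma sum_degree:
  assumes "finite (verts H)" "\<And>e. e \<in># edges H \<Longrightarrow> e \<subseteq> verts H"
  shows "(\<Sum>v\<in>verts H. degree H v) = (\<Sum>e\<in>#edges H. card e)"
proof -
  have "(\<Sum>v\<in>W. size {#e \<in># M. v \<in> e#}) = (\<Sum>e\<in>#M. card e)"
    if "finite W" "\<And>e. e \<in># M \<Longrightarrow> e \<subseteq> W" for W :: "'a set" and M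
    using that(2)
  proof (induction M)
    case (add e M)
    have "(\<Sum>v\<in>W. size {#e' \<in># add_mset e M. v \<in> e'#}) =
        (\<Sum>v\<in>W. of_bool (v \<in> e) + size {#e' \<in># M. v \<in> e'#})"
      by (intro sum.cong) auto
    moreover have "W \<inter> e = e" using add.prems by auto
    ultimately show ?case using add that(1) by (simp add: sum.distrib)
  qed simp
  then show ?thesis using assms unfolding degree_def by blast
qed

text \<open>An edge of size i + 1 contributes i, so the sum in (vi) is the sum of |e| - 1 over all
  edges.\<close>

lemma sum_num_edges_of_size:
  assumes "\<And>e. e \<in># edges H \<Longrightarrow> 1 \<le> card e \<and> card e \<le> h"
  shows "(\<Sum>i = 1..h - 1. i * num_edges_of_size H (i + 1)) + size (edges H) = (\<Sum>e\<in>#edges H. card e)"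
proof -
  have "(\<Sum>i = 1..h - 1. i * size {#e \<in># M. card e = i + 1#}) + size M = (\<Sum>e\<in>#M. card e)"
    if "\<And>e. e \<in># M \<Longrightarrow> 1 \<le> card e \<and> card e \<le> h" for M :: "'a set multiset"
    using that
  proof (induction M)
    case (add e M)
    have e: "1 \<le> card e" "card e \<le> h" using add.prems by auto
    have "(\<Sum>i = 1..h - 1. i * size {#e' \<in># add_mset e M. card e' = i + 1#}) =
        (\<Sum>i = 1..h - 1. (if i = card e - 1 then i else 0) + i * size {#e' \<in># M. card e' = i + 1#})"
      using e by (intro sum.cong) auto
    also have "\<dots> = (card e - 1) + (\<Sum>i = 1..h - 1. i * size {#e' \<in># M. card e' = i + 1#})"
      using e by (auto simp: sum.distrib)
    finally have "(\<Sum>i = 1..h - 1. i * size {#e' \<in># add_mset e M. card e' = i + 1#}) + size (add_mset e M) =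
        (card e - 1) + (\<Sum>i = 1..h - 1. i * size {#e' \<in># M. card e' = i + 1#}) + (size M + 1)" by simp
    also have "\<dots> = card e + ((\<Sum>i = 1..h - 1. i * size {#e' \<in># M. card e' = i + 1#}) + size M)"
      using e by simp
    also have "\<dots> = card e + (\<Sum>e\<in>#M. card e)" using add by auto
    finally show ?case by simp
  qed simp
  then show ?thesis using assms unfolding num_edges_of_size_def by blast
qed

text \<open>A set of reached nodes grows by at most \<open>card (f i) - 1\<close> whenever a new edge \<open>f i\<close> is used.\<close>
lemma card_le_of_connected:
  fixes f :: "'i \<Rightarrow> 'n set"
  assumes "finite C" "\<And>i. i \<in> C \<Longrightarrow> finite (f i)"
    and "\<And>y. y \<in> N \<Longrightarrow> (v, y) \<in> {(x, y). \<exists>i\<in>C. x \<in> f i \<and> y \<in> f i}\<^sup>*"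
  shows "card N \<le> 1 + (\<Sum>i\<in>C. card (f i) - 1)"
proof -
  define good where "good = (\<lambda>D. D \<subseteq> C \<and> card (insert v (\<Union>(f ` D))) \<le> 1 + (\<Sum>i\<in>D. card (f i) - 1))"
  have "good {}" by (simp add: good_def)
  have "finite {D. good D}" using assms(1) by (auto simp: good_def)
  \<comment> \<open>By maximality no edge can meet the reached set \<open>R\<close> and leave it,
    since such an edge could still be added. Hence \<open>R\<close> is closed under
    adjacency.\<close>
  then obtain D where D: "good D" "\<And>D'. good D' \<Longrightarrow> D \<subseteq> D' \<Longrightarrow> D = D'"
    using finite_has_maximal[of "{D. good D}"] \<open>good {}\<close> by auto
  define R where "R = insert v (\<Union>(f ` D))"
  have finD: "finite D" "D \<subseteq> C" using D(1) assms(1) finite_subset by (auto simp: good_def)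
  then have finR: "finite R" using assms(2) by (auto simp: R_def)
  have closed: "f i \<subseteq> R" if "i \<in> C" "x \<in> f i" "x \<in> R" for i x
  proof (rule ccontr)
    assume not: "\<not> f i \<subseteq> R"
    then have "i \<notin> D" by (auto simp: R_def)
    have fi: "finite (f i)" using assms(2) that by blast
    have "card (f i \<union> R) + card (f i \<inter> R) = card (f i) + card R"
      using card_Un_Int[OF fi finR] by simp
    moreover have "card (f i \<inter> R) \<ge> 1" using that fi by (auto simp: Suc_le_eq card_gt_0_iff)
    ultimately have "card (f i \<union> R) \<le> card R + (card (f i) - 1)" by linarith
    moreover have "insert v (\<Union>(f ` insert i D)) = f i \<union> R" by (auto simp: R_def)
    moreover have "card R \<le> 1 + (\<Sum>i\<in>D. card (f i) - 1)" using D(1) by (simp add: good_def R_def)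
    ultimately have "good (insert i D)"
      using finD \<open>i \<notin> D\<close> that(1) by (simp add: good_def)
    then show False using D(2)[of "insert i D"] \<open>i \<notin> D\<close> by auto
  qed
  have "y \<in> R" if "(v, y) \<in> {(x, y). \<exists>i\<in>C. x \<in> f i \<and> y \<in> f i}\<^sup>*" for y
    using that
  proof (induction rule: rtrancl_induct)
    case (step y z)
    then show ?case using closed by blast
  qed (simp add: R_def)
  then have "N \<subseteq> R" using assms(3) by blast
  then have "card N \<le> card R" using finR by (rule card_mono[rotated])
  also have "\<dots> \<le> 1 + (\<Sum>i\<in>D. card (f i) - 1)" using D(1) by (simp add: good_def R_def)
  also have "(\<Sum>i\<in>D. card (f i) - 1) \<le> (\<Sum>i\<in>C. card (f i) - 1)"
    using finD assms(1) by (intro sum_mono2) auto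
  finally show ?thesis by simp
qed

text \<open>Indexing makes equal copies distinguishable, so a multiset of coloured edges can be
  handled as a finite set with maps.\<close>

lemma mset_as_image:
  fixes M :: "'b multiset"
  obtains I :: "nat set" and g where "finite I" "M = image_mset g (mset_set I)"
proof -
  obtain xs where "mset xs = M" using ex_mset by blast
  then have "M = mset (map (nth xs) [0..<length xs])" by (simp add: map_nth)
  also have "\<dots> = image_mset (nth xs) (mset_set {0..<length xs})" by (simp only: mset_map mset_upt)
  finally show thesis by (rule that[rotated]) simp
qed

lemma filter_image_mset_set:
  "finite I \<Longrightarrow> filter_mset P (image_mset g (mset_set I)) = image_mset g (mset_set {i \<in> I. P (g i)})"
  by (simp add: filter_mset_image_mset filter_mset_mset_set)

lemma count_image_mset_set:
  "finite I \<Longrightarrow> count (image_mset g (mset_set I)) y = card {i \<in> I. g i = y}"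
  by (simp add: count_conv_size_mset filter_image_mset_set)

lemma size_filter_repeat_mset: "size (filter_mset P (repeat_mset q M)) = q * size (filter_mset P M)"
  by (induction q) (simp_all add: repeat_mset_Suc)

text \<open>Such an edge is \<open>B\<close> together with an arbitrary subset of \<open>V\<close>
  of size h - |B|. With \<open>X - {v}\<close> in place of \<open>V\<close> and \<open>{v}\<close>
  in place of \<open>B\<close> this also counts the edges through \<open>v\<close>.\<close>

lemma card_supersets_with_trace:
  assumes "finite X" "V \<subseteq> X" "B \<subseteq> X - V" "card B \<le> h"
  shows "card {e. e \<subseteq> X \<and> card e = h \<and> e - V = B} = card V choose (h - card B)"
proof -
  have fin: "finite V" "finite B"
    using assms finite_subset[of V X] finite_subset[of B X] by auto
  have "bij_betw (\<lambda>D. B \<union> D) {D. D \<subseteq> V \<and> card D = h - card B} {e. e \<subseteq> X \<and> card e = h \<and> e - V = B}"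
  proof (rule bij_betw_byWitness[where f' = "\<lambda>e. e \<inter> V"])
    show "(\<lambda>D. B \<union> D) ` {D. D \<subseteq> V \<and> card D = h - card B} \<subseteq> {e. e \<subseteq> X \<and> card e = h \<and> e - V = B}"
    proof (intro image_subsetI)
      fix D assume "D \<in> {D. D \<subseteq> V \<and> card D = h - card B}"
      moreover then have "card (B \<union> D) = card B + card D"
        using assms fin finite_subset[of D V] by (intro card_Un_disjoint) auto
      ultimately show "B \<union> D \<in> {e. e \<subseteq> X \<and> card e = h \<and> e - V = B}" using assms by auto
    qed
    show "(\<lambda>e. e \<inter> V) ` {e. e \<subseteq> X \<and> card e = h \<and> e - V = B} \<subseteq> {D. D \<subseteq> V \<and> card D = h - card B}"
    proof (intro image_subsetI)
      fix e assume e: "e \<in> {e. e \<subseteq> X \<and> card e = h \<and> e - V = B}"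
      then have "finite e" using assms finite_subset by auto
      then have "card e = card (e - V) + card (e \<inter> V)"
        by (metis add.commute card_Int_Diff)
      then show "e \<inter> V \<in> {D. D \<subseteq> V \<and> card D = h - card B}" using e by auto
    qed
  qed (use assms in auto)
  then have "card {D. D \<subseteq> V \<and> card D = h - card B} = card {e. e \<subseteq> X \<and> card e = h \<and> e - V = B}"
    by (rule bij_betw_same_card)
  then show ?thesis using n_subsets[OF fin(1)] by simp
qed

section \<open>Extending a partial factorization\<close>

locale extension_problem =
  fixes n m h r lam :: nat and k :: real and X V :: "'a set"
    and G H :: "'a hypergraph" and c :: "('a set \<times> nat) multiset"
  assumes pos: "n > 0" "m > 0" "h > 0" "r > 0" "lam > 0"
    and nm: "n > m" and mh: "m > h"
    and finX: "finite X" and cardX: "card X = n"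
    and G_eq: "G = complete_hypergraph lam h X"
    and V_sub: "V \<subseteq> verts G" and cardV: "card V = m"
    and H_eq: "H = delete_vertices G V"
    and k_eq: "k = real lam / real r * real ((n - 1) choose (h - 1))"
    and partial: "partial_factorization r k H c"
begin

section \<open>Edge counts and degrees in \<open>G\<close> and \<open>H\<close>\<close>

lemma verts_G: "verts G = X" and verts_H: "verts H = X - V"
  by (simp_all add: G_eq H_eq complete_hypergraph_def delete_vertices_def)

lemma VX: "V \<subseteq> X" and finV: "finite V"
  using V_sub finX finite_subset by (auto simp: verts_G)

lemma cardXV: "card (X - V) = n - m"
  using VX finV cardX cardV by (simp add: card_Diff_subset)

lemma size_filter_edges_G:
  "size (filter_mset P (edges G)) = lam * card {e. e \<subseteq> X \<and> card e = h \<and> P e}"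
proof -
  have fin: "finite {e. e \<subseteq> X \<and> card e = h}" using finX by simp
  have "{e. e \<subseteq> X \<and> card e = h \<and> P e} = {e \<in> {e. e \<subseteq> X \<and> card e = h}. P e}" by auto
  then show ?thesis using fin
    by (simp add: G_eq complete_hypergraph_def size_filter_repeat_mset filter_mset_mset_set)
qed

lemma mem_edges_G: "e \<in># edges G \<longleftrightarrow> e \<subseteq> X \<and> card e = h"
proof -
  have "finite {e. e \<subseteq> X \<and> card e = h}" using finX by simp
  then show ?thesis using pos(5)
    by (simp add: G_eq complete_hypergraph_def count_greater_zero_iff[symmetric] count_mset_set' del: count_greater_zero_iff)
qed

lemma mem_edges_H:
  assumes "e \<in># edges H"
  shows "e \<noteq> {}" "e \<subseteq> X - V" "1 \<le> card e" "card e \<le> h"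
proof -
  obtain e' where e': "e' \<in># edges G" "\<not> e' \<subseteq> V" "e = e' - V"
    using assms by (auto simp: H_eq delete_vertices_def)
  then have "e' \<subseteq> X" "card e' = h" by (auto simp: mem_edges_G)
  then show "e \<noteq> {}" "e \<subseteq> X - V" using e' by auto
  have "finite e'" using \<open>e' \<subseteq> X\<close> finX finite_subset by auto
  then show "1 \<le> card e" "card e \<le> h" using e' \<open>card e' = h\<close>
    by (auto simp: Suc_le_eq card_gt_0_iff intro!: card_mono)
qed

lemma fst_c: "image_mset fst c = edges H" and snd_c: "x \<in># c \<Longrightarrow> snd x \<in> colours k"
  using partial by (auto simp: partial_factorization_def edge_colouring_def)

lemma fst_c_mem: "x \<in># c \<Longrightarrow> fst x \<in># edges H"
  using fst_c by (metis image_eqI set_image_mset)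

lemma size_filter_edges_H:
  "size {#e \<in># edges H. P e#} = lam * card {e. e \<subseteq> X \<and> card e = h \<and> \<not> e \<subseteq> V \<and> P (e - V)}"
  by (simp add: H_eq delete_vertices_def filter_mset_image_mset filter_filter_mset
      size_filter_edges_G conj_commute)

lemma size_filter_fst_c: "size {#x \<in># c. P (fst x)#} = size {#e \<in># edges H. P e#}"
  by (simp add: fst_c[symmetric] filter_mset_image_mset)

lemma count_c:
  assumes "B \<subseteq> X - V" "B \<noteq> {}" "card B \<le> h"
  shows "size {#x \<in># c. fst x = B#} = lam * (m choose (h - card B))"
proof -
  have "size {#x \<in># c. fst x = B#} = size {#e \<in># edges H. e = B#}" by (rule size_filter_fst_c)
  also have "\<dots> = lam * card {e. e \<subseteq> X \<and> card e = h \<and> \<not> e \<subseteq> V \<and> e - V = B}"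
    by (rule size_filter_edges_H)
  also have "{e. e \<subseteq> X \<and> card e = h \<and> \<not> e \<subseteq> V \<and> e - V = B} = {e. e \<subseteq> X \<and> card e = h \<and> e - V = B}"
    using assms by auto
  finally show ?thesis using card_supersets_with_trace[OF finX VX assms(1,3)] cardV by simp
qed

text \<open>The edges missing from \<open>H\<close> lie inside \<open>V\<close>. Their number
  \<lambda> C(m,h) is what the edges concentrated on the amalgamated vertex have to add up
  to.\<close>

lemma size_c: "size c + lam * (m choose h) = lam * (n choose h)"
proof -
  have "size c = lam * card {e. e \<subseteq> X \<and> card e = h \<and> \<not> e \<subseteq> V}"
    using size_filter_fst_c[of "\<lambda>_. True"] size_filter_edges_H[of "\<lambda>_. True"] by simp
  moreover have "card {e. e \<subseteq> X \<and> card e = h} =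
      card {e. e \<subseteq> X \<and> card e = h \<and> \<not> e \<subseteq> V} + card {e. e \<subseteq> V \<and> card e = h}"
    using finX finV VX by (subst card_Un_disjoint[symmetric]) (auto intro!: arg_cong[of _ _ card])
  then have "card {e. e \<subseteq> X \<and> card e = h \<and> \<not> e \<subseteq> V} + (m choose h) = n choose h"
    using n_subsets[OF finX] n_subsets[OF finV] cardX cardV by simp
  ultimately show ?thesis by (simp add: distrib_left[symmetric])
qed

lemma degree_G:
  assumes "v \<in> X"
  shows "degree G v = lam * ((n - 1) choose (h - 1))"
proof -
  have "degree G v = lam * card {e. e \<subseteq> X \<and> card e = h \<and> v \<in> e}"
    unfolding degree_def by (rule size_filter_edges_G)
  also have "{e. e \<subseteq> X \<and> card e = h \<and> v \<in> e} = {e. e \<subseteq> X \<and> card e = h \<and> e - (X - {v}) = {v}}"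
    using assms by auto
  also have "card \<dots> = card (X - {v}) choose (h - card {v})"
    using assms finX pos by (intro card_supersets_with_trace) auto
  finally show ?thesis using assms finX cardX by simp
qed

lemma mem_class_H: "e \<in># edges (colour_class H c j) \<Longrightarrow> e \<in># edges H"
  using fst_c_mem by (auto simp: colour_class_def)

lemma class_sizes:
  assumes "regular r (colour_class H c j)"
  shows "(\<Sum>e\<in>#edges (colour_class H c j). card e) = r * (n - m)"
    and "(\<Sum>i = 1..h - 1. i * num_edges_of_size (colour_class H c j) (i + 1)) +
      size (edges (colour_class H c j)) = r * (n - m)"
proof -
  let ?F = "colour_class H c j"
  have vF: "verts ?F = X - V" by (simp add: colour_class_def verts_H)
  have "(\<Sum>v\<in>verts ?F. degree ?F v) = (\<Sum>e\<in>#edges ?F. card e)"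
    using mem_class_H mem_edges_H(2) finX by (intro sum_degree) (auto simp: vF)
  moreover have "(\<Sum>v\<in>verts ?F. degree ?F v) = (\<Sum>v\<in>verts ?F. r)"
    using assms by (intro sum.cong) (auto simp: regular_def)
  ultimately show 1: "(\<Sum>e\<in>#edges ?F. card e) = r * (n - m)" using cardXV by (simp add: vF)
  show "(\<Sum>i = 1..h - 1. i * num_edges_of_size ?F (i + 1)) + size (edges ?F) = r * (n - m)"
    unfolding 1[symmetric] using mem_class_H mem_edges_H(3,4) by (intro sum_num_edges_of_size) blast
qed

lemma edge_bound_iff:
  "h dvd r * n \<Longrightarrow> real q \<le> real r * real n / real h \<longleftrightarrow> q \<le> r * n div h"
  by (metis of_nat_le_iff of_nat_mult real_of_nat_div)

text \<open>For a regular class the sum in (vi) is r(n-m) - |E|, so (vi) becomes c + (rn/h - |E|)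
  \<le> (r-1)m + 1. Negative terms are moved across to avoid truncated subtraction.\<close>

lemma component_bound_iff:
  assumes "regular r (colour_class H c j)" "h dvd r * n"
  shows "real (num_components (colour_class H c j)) \<le> real r * real n * (1 - 1 / real h)
          - (\<Sum>i = 1..h - 1. real i * real (num_edges_of_size (colour_class H c j) (i + 1)))
          - real m + 1 \<longleftrightarrow>
    num_components (colour_class H c j) + m + r * n div h \<le>
      r * m + size (edges (colour_class H c j)) + 1"
proof -
  let ?F = "colour_class H c j"
  have "real (r * n div h) = real r * real n / real h"
    using assms(2) by (metis of_nat_mult real_of_nat_div)
  then have 1: "real r * real n * (1 - 1 / real h) = real r * real n - real (r * n div h)"
    by (simp add: algebra_simps)
  have "real (\<Sum>i = 1..h - 1. i * num_edges_of_size ?F (i + 1)) + real (size (edges ?F)) =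
      real r * (real n - real m)"
    using class_sizes(2)[OF assms(1)] nm by (metis less_imp_le of_nat_add of_nat_diff of_nat_mult)
  then have 2: "(\<Sum>i = 1..h - 1. real i * real (num_edges_of_size ?F (i + 1))) =
      real r * real n - real r * real m - real (size (edges ?F))"
    by (simp add: algebra_simps)
  have "real (num_components ?F) \<le> real r * real n * (1 - 1 / real h)
          - (\<Sum>i = 1..h - 1. real i * real (num_edges_of_size ?F (i + 1))) - real m + 1 \<longleftrightarrow>
      real (num_components ?F + m + r * n div h) \<le> real (r * m + size (edges ?F) + 1)"
    unfolding 1 2 by simp linarith
  then show ?thesis by (simp only: of_nat_le_iff)
qed

lemma finite_colours: "finite (colours k)"
proof -
  have "colours k \<subseteq> {..nat \<lceil>k\<rceil>}" by (auto simp: colours_def) linarith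
  then show ?thesis using finite_subset by blast
qed

lemma edge_in_G: "\<exists>e. e \<in># edges G"
proof -
  have "h \<le> card X" using cardX nm mh by simp
  then obtain e where "e \<subseteq> X" "card e = h" using obtain_subset_with_card_n by metis
  then show ?thesis using mem_edges_G by blast
qed

section \<open>From a connected factorization to the six conditions\<close>

lemma necessity:
  assumes conn: "connected_factorization r k G d" and ext: "extends_colouring V d c"
  shows "admissible h n r lam" "r \<ge> 2"
    and "j \<in> colours k \<Longrightarrow> regular r (colour_class H c j)"
    and "j \<in> colours k \<Longrightarrow> K \<in> components (colour_class H c j) \<Longrightarrow> \<not> uniform h K"
    and "j \<in> colours k \<Longrightarrow> size (edges (colour_class H c j)) \<le> r * n div h"
    and "j \<in> colours k \<Longrightarrow> num_components (colour_class H c j) + m + r * n div h \<le>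
      r * m + size (edges (colour_class H c j)) + 1"
proof -
  obtain I :: "nat set" and g where I: "finite I" "d = image_mset g (mset_set I)"
    by (rule mset_as_image)
  define A where "A = (\<lambda>i. fst (g i))"
  define col where "col = (\<lambda>i. snd (g i))"
  define C where "C = (\<lambda>j. {i \<in> I. col i = j})"
  have finC: "finite (C j)" for j using I by (simp add: C_def)
  have fst_d: "image_mset A (mset_set I) = edges G"
    using conn by (simp add: connected_factorization_def edge_colouring_def I A_def image_mset.compositionality comp_def)
  then have A_G: "A i \<in># edges G" if "i \<in> I" for i
    using that I by (metis finite_set_mset_mset_set image_eqI set_image_mset)
  then have A: "A i \<subseteq> X" "card (A i) = h" "finite (A i)" if "i \<in> I" for i
    using that finX finite_subset[of "A i" X] by (auto simp: mem_edges_G)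
  have col: "col i \<in> colours k" if "i \<in> I" for i
    using conn that I by (auto simp: connected_factorization_def edge_colouring_def col_def)
  have classG: "edges (colour_class G d j) = image_mset A (mset_set (C j))" for j
    using I by (simp add: colour_class_def filter_image_mset_set image_mset.compositionality comp_def A_def C_def col_def)
  have vG: "verts (colour_class G d j) = X" for j by (simp add: colour_class_def verts_G)
  have c: "c = image_mset (\<lambda>i. (A i - V, col i)) (mset_set {i \<in> I. \<not> A i \<subseteq> V})"
    using ext I
    by (simp add: extends_colouring_def filter_image_mset_set image_mset.compositionality comp_def
        A_def col_def case_prod_beta)
  define D where "D = (\<lambda>j. {i \<in> C j. \<not> A i \<subseteq> V})"
  have finD: "finite (D j)" for j using finC by (simp add: D_def)
  have classH: "edges (colour_class H c j) = image_mset (\<lambda>i. A i - V) (mset_set (D j))" for j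
  proof -
    have "{i \<in> {i \<in> I. \<not> A i \<subseteq> V}. col i = j} = D j" by (auto simp: C_def D_def)
    then show ?thesis using I
      by (simp add: colour_class_def c filter_image_mset_set image_mset.compositionality comp_def)
  qed
  have vH: "verts (colour_class H c j) = X - V" for j by (simp add: colour_class_def verts_H)
  have degG: "card {i \<in> C j. v \<in> A i} = r" if "j \<in> colours k" "v \<in> X" for j v
  proof -
    have "degree (colour_class G d j) v = r"
      using conn that vG by (auto simp: connected_factorization_def is_factor_def regular_def)
    then show ?thesis using finC by (simp add: degree_def classG filter_image_mset_set)
  qed
  have cardC: "card (C j) * h = r * n" if "j \<in> colours k" for j
  proof -
    have "(\<Sum>v\<in>verts (colour_class G d j). degree (colour_class G d j) v) =
        (\<Sum>e\<in>#edges (colour_class G d j). card e)"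
    proof (rule sum_degree)
      show "e \<subseteq> verts (colour_class G d j)" if "e \<in># edges (colour_class G d j)" for e
        using that A(1) finC unfolding classG vG by (auto simp: C_def)
    qed (simp add: vG finX)
    also have "\<dots> = (\<Sum>i\<in>C j. card (A i))"
      by (simp add: classG image_mset.compositionality comp_def sum_unfold_sum_mset)
    also have "\<dots> = card (C j) * h" using A by (simp add: C_def)
    also have "(\<Sum>v\<in>verts (colour_class G d j). degree (colour_class G d j) v) = (\<Sum>v\<in>X. r)"
      using conn that vG by (intro sum.cong) (auto simp: connected_factorization_def is_factor_def regular_def)
    finally show ?thesis using cardX by (simp add: mult.commute)
  qed
  have conG: "(u, v) \<in> {(x, y). \<exists>i\<in>C j. x \<in> A i \<and> y \<in> A i}\<^sup>*"
    if "j \<in> colours k" "u \<in> X" "v \<in> X" for j u v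
  proof -
    have "adj (colour_class G d j) = {(x, y). \<exists>i\<in>C j. x \<in> A i \<and> y \<in> A i}"
      using finC by (auto simp: classG)
    moreover have "connected_hypergraph (colour_class G d j)"
      using conn that by (simp add: connected_factorization_def)
    ultimately show ?thesis using that vG by (simp add: connected_hypergraph_iff)
  qed
  obtain i0 where i0: "i0 \<in> I"
    using edge_in_G fst_d I by (metis ex_in_conv image_mset_empty mset_set.empty set_mset_empty)
  obtain v0 where v0: "v0 \<in> X" using cardX pos by fastforce
  have hrn: "h dvd r * n" using cardC[OF col[OF i0]] by (metis dvd_triv_right)

  have "degree G v0 = card {i \<in> I. v0 \<in> A i}"
    using I by (simp add: degree_def fst_d[symmetric] filter_image_mset_set)
  also have "\<dots> = (\<Sum>j\<in>colours k. card {i \<in> {i \<in> I. v0 \<in> A i}. col i = j})"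
  proof -
    have "col ` {i \<in> I. v0 \<in> A i} \<subseteq> colours k" using col by auto
    then show ?thesis
      using sum.group[of "{i \<in> I. v0 \<in> A i}" "colours k" col "\<lambda>_. 1::nat"] I finite_colours by simp
  qed
  also have "\<dots> = (\<Sum>j\<in>colours k. r)"
  proof (rule sum.cong)
    fix j assume "j \<in> colours k"
    moreover have "{i \<in> {i \<in> I. v0 \<in> A i}. col i = j} = {i \<in> C j. v0 \<in> A i}" by (auto simp: C_def)
    ultimately show "card {i \<in> {i \<in> I. v0 \<in> A i}. col i = j} = r" using degG v0 by simp
  qed simp
  finally have "r dvd lam * ((n - 1) choose (h - 1))" using degree_G[OF v0] by simp
  then show "admissible h n r lam" using hrn by (simp add: admissible_def)

  show "r \<ge> 2"
  proof (rule ccontr)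
    assume "\<not> r \<ge> 2"
    then have "r = 1" using pos by simp
    define j where "j = col i0"
    have j: "j \<in> colours k" using col i0 by (simp add: j_def)
    \<comment> \<open>For r = 1 the class has n/h edges, and connectedness requires n \<le> 1 +
      (n/h)(h-1), that is n \<le> h.\<close>
    have "card X \<le> 1 + (\<Sum>i\<in>C j. card (A i) - 1)"
      using conG[OF j v0] finC A by (intro card_le_of_connected[of _ _ _ v0]) (auto simp: C_def)
    also have "(\<Sum>i\<in>C j. card (A i) - 1) = card (C j) * (h - 1)" using A by (simp add: C_def)
    finally have "card (C j) * h \<le> 1 + card (C j) * (h - 1)" using cardC[OF j] \<open>r = 1\<close> cardX by simp
    moreover have "card (C j) * h = card (C j) * (h - 1) + card (C j)"
      using pos(3) by (cases h) auto
    ultimately have "card (C j) \<le> 1" by linarith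
    then have "card (C j) * h \<le> h" by (cases "card (C j)") auto
    then show False using cardC[OF j] \<open>r = 1\<close> nm mh by simp
  qed

  show reg: "regular r (colour_class H c j)" if j: "j \<in> colours k" for j
    unfolding regular_def vH
  proof
    fix v assume v: "v \<in> X - V"
    have "degree (colour_class H c j) v = card {i \<in> D j. v \<in> A i - V}"
      using finD by (simp add: degree_def classH filter_image_mset_set)
    also have "{i \<in> D j. v \<in> A i - V} = {i \<in> C j. v \<in> A i}" using v by (auto simp: D_def)
    finally show "degree (colour_class H c j) v = r" using degG[OF j] v by simp
  qed

  show "\<not> uniform h K" if j: "j \<in> colours k" and K: "K \<in> components (colour_class H c j)" for j K
  proof
    assume unif: "uniform h K"
    let ?L = "linked (colour_class H c j)"
    obtain Q where Q: "Q \<in> (X - V) // ?L"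
      "K = \<lparr>verts = Q, edges = {#e \<in># edges (colour_class H c j). e \<subseteq> Q#}\<rparr>"
      using K by (auto simp: components_def vH)
    then obtain w where w: "w \<in> X - V" "Q = ?L `` {w}" by (auto elim: quotientE)
    obtain z where z: "z \<in> V" using cardV pos by fastforce
    have "(w, z) \<in> {(x, y). \<exists>i\<in>C j. x \<in> A i \<and> y \<in> A i}\<^sup>*"
      using conG[OF j] w z VX by auto
    \<comment> \<open>If the component is uniform, an edge of the colour class of \<open>G\<close>
      that meets \<open>Q\<close> has all its h vertices outside \<open>V\<close>. A path starting
      in \<open>Q\<close> thus never leaves \<open>Q\<close>, although it should reach
      \<open>V\<close>.\<close>
    then have "z \<in> Q"
    proof (induction rule: rtrancl_induct)
      case base
      show ?case using w by (auto simp: linked_def vH)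
    next
      case (step y z)
      then obtain i where i: "i \<in> C j" "y \<in> A i" "z \<in> A i" by auto
      have "y \<in> X - V" "(w, y) \<in> ?L" using step w by (auto simp: linked_def vH)
      then have iD: "A i - V \<in># edges (colour_class H c j)" "y \<in> A i - V"
        using i finD by (auto simp: classH D_def)
      have "A i \<subseteq> X" "card (A i) = h" "finite (A i)" using i A by (auto simp: C_def)
      have sub: "A i - V \<subseteq> Q"
      proof
        fix x assume "x \<in> A i - V"
        then have "(y, x) \<in> ?L" using iD \<open>A i \<subseteq> X\<close> by (intro linked_edge[of "A i - V"]) (auto simp: vH)
        then show "x \<in> Q" using \<open>(w, y) \<in> ?L\<close> equiv_linked[of "colour_class H c j"] w
          by (auto elim!: equivE dest: transD)
      qed
      then have "card (A i - V) = h" using unif iD by (simp add: uniform_def Q(2))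
      then have "A i - V = A i"
        using \<open>card (A i) = h\<close> \<open>finite (A i)\<close> by (intro card_subset_eq) auto
      then show ?case using sub i by auto
    qed
    then show False using w z by (auto simp: linked_def vH)
  qed

  have sz: "size (edges (colour_class H c j)) = card (D j)" for j by (simp add: classH)
  have DC: "card (D j) \<le> card (C j)" for j using finC by (intro card_mono) (auto simp: D_def)
  have Cdiv: "r * n div h = card (C j)" if "j \<in> colours k" for j
    using cardC[OF that] pos by (metis nonzero_mult_div_cancel_right less_numeral_extra(3))
  show "size (edges (colour_class H c j)) \<le> r * n div h" if "j \<in> colours k" for j
    using DC by (simp add: sz Cdiv[OF that])

  show "num_components (colour_class H c j) + m + r * n div h \<le>
      r * m + size (edges (colour_class H c j)) + 1" if j: "j \<in> colours k" for j
  proof -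
    let ?L = "linked (colour_class H c j)"
    \<comment> \<open>The contraction: vertices of \<open>V\<close> stay apart as singletons, all
      others become their components. Components avoid \<open>V\<close>, so the two kinds of nodes
      differ.\<close>
    define f where "f = (\<lambda>x. if x \<in> V then {x} else ?L `` {x})"
    have LX: "?L `` {x} \<subseteq> X - V" for x by (auto simp: linked_def vH)
    have fX: "f ` X = (\<lambda>x. {x}) ` V \<union> (X - V) // ?L"
      using VX by (auto simp: f_def quotient_def)
    have "card (f ` X) = card ((\<lambda>x. {x}) ` V) + card ((X - V) // ?L)"
      unfolding fX
    proof (rule card_Un_disjoint)
      show "finite ((X - V) // ?L)" using finX by (simp add: quotient_def)
      show "(\<lambda>x. {x}) ` V \<inter> (X - V) // ?L = {}" using LX by (force simp: quotient_def)
    qed (simp add: finV)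
    then have nodes: "card (f ` X) = m + num_components (colour_class H c j)"
      by (simp add: card_image cardV num_components_eq vH)
    have "(f v0, y) \<in> {(x, y). \<exists>i\<in>C j. x \<in> f ` A i \<and> y \<in> f ` A i}\<^sup>*" if "y \<in> f ` X" for y
    proof -
      have "(f v0, f x) \<in> {(x, y). \<exists>i\<in>C j. x \<in> f ` A i \<and> y \<in> f ` A i}\<^sup>*"
        if "(v0, x) \<in> {(x, y). \<exists>i\<in>C j. x \<in> A i \<and> y \<in> A i}\<^sup>*" for x
        using that
      proof (induction rule: rtrancl_induct)
        case (step y z)
        then have "(f y, f z) \<in> {(x, y). \<exists>i\<in>C j. x \<in> f ` A i \<and> y \<in> f ` A i}" by auto
        with step.IH show ?case by (rule rtrancl_into_rtrancl)
      qed simp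
      then show ?thesis using that conG[OF j v0] by auto
    qed
    then have "card (f ` X) \<le> 1 + (\<Sum>i\<in>C j. card (f ` A i) - 1)"
      using finC A by (intro card_le_of_connected[of _ _ _ "f v0"]) (auto simp: C_def)
    \<comment> \<open>The part of an edge e outside \<open>V\<close> collapses to one node. If that
      part is nonempty, e has at most 1 + |e \<inter> V| nodes and contributes at most h - |e -
      V|.\<close>
    also have "(\<Sum>i\<in>C j. card (f ` A i) - 1) \<le>
        (\<Sum>i\<in>C j. if A i \<subseteq> V then h - 1 else h - card (A i - V))"
    proof (rule sum_mono)
      fix i assume i: "i \<in> C j"
      then have Ai: "A i \<subseteq> X" "card (A i) = h" "finite (A i)" using A by (auto simp: C_def)
      show "card (f ` A i) - 1 \<le> (if A i \<subseteq> V then h - 1 else h - card (A i - V))"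
      proof (cases "A i \<subseteq> V")
        case True
        then show ?thesis using card_image_le[OF Ai(3), of f] Ai(2) by simp
      next
        case False
        then obtain y where y: "y \<in> A i - V" by auto
        have iD: "A i - V \<in># edges (colour_class H c j)" using i finD False by (auto simp: classH D_def)
        have "f x = f y" if "x \<in> A i - V" for x
        proof -
          have "(x, y) \<in> ?L" using iD Ai y that by (intro linked_edge[of "A i - V"]) (auto simp: vH)
          then show ?thesis using y that equiv_class_eq[OF equiv_linked] by (simp add: f_def)
        qed
        then have "f ` A i \<subseteq> insert (f y) (f ` (A i \<inter> V))" by auto
        then have "card (f ` A i) \<le> card (insert (f y) (f ` (A i \<inter> V)))"
          using Ai by (intro card_mono) auto
        also have "\<dots> \<le> card (A i \<inter> V) + 1"
          using card_image_le[of "A i \<inter> V" f] Ai by (simp add: card_insert_if)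
        also have "card (A i \<inter> V) = h - card (A i - V)"
          using card_Int_Diff[OF Ai(3), of V] Ai(2) by simp
        finally show ?thesis using False by simp
      qed
    qed
    also have "\<dots> = (\<Sum>i\<in>C j - D j. h - 1) + (\<Sum>i\<in>D j. h - card (A i - V))"
    proof -
      have "{i \<in> C j. A i \<subseteq> V} = C j - D j" "{i \<in> C j. \<not> A i \<subseteq> V} = D j" by (auto simp: D_def)
      then show ?thesis using finC by (simp add: sum.If_cases Int_def Collect_neg_eq[symmetric])
    qed
    finally have le: "m + num_components (colour_class H c j) \<le>
        1 + ((card (C j) - card (D j)) * (h - 1) + (\<Sum>i\<in>D j. h - card (A i - V)))"
      using finD by (simp add: nodes card_Diff_subset D_def finC)
    have "(\<Sum>i\<in>D j. h - card (A i - V)) + (\<Sum>i\<in>D j. card (A i - V)) = card (D j) * h"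
    proof -
      have "card (A i - V) \<le> h" if "i \<in> D j" for i
        using that A[of i] card_mono[of "A i" "A i - V"] by (auto simp: D_def C_def)
      then show ?thesis by (simp add: sum.distrib[symmetric])
    qed
    moreover have "(\<Sum>i\<in>D j. card (A i - V)) = r * (n - m)"
      using class_sizes(1)[OF reg[OF j]]
      by (simp add: classH image_mset.compositionality comp_def sum_unfold_sum_mset)
    moreover have "(card (C j) - card (D j)) * (h - 1) + card (D j) * h + card (C j) =
        card (C j) * h + card (D j)"
    proof -
      obtain t where t: "card (C j) = card (D j) + t" using DC le_Suc_ex by blast
      obtain h' where "h = Suc h'" using pos(3) by (cases h) auto
      then show ?thesis unfolding t by (simp add: algebra_simps)
    qed
    moreover have "r * n = r * m + r * (n - m)" using nm by (simp add: distrib_left[symmetric])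
    ultimately show ?thesis using le cardC[OF j] unfolding sz Cdiv[OF j] by linarith
  qed
qed

section \<open>Building the factorization from the amalgamation of \<open>V\<close>\<close>

lemma sufficiency:
  assumes adm: "admissible h n r lam"
    and reg: "\<And>j. j \<in> colours k \<Longrightarrow> regular r (colour_class H c j)"
    and nunif: "\<And>j K. j \<in> colours k \<Longrightarrow> K \<in> components (colour_class H c j) \<Longrightarrow> \<not> uniform h K"
    and few_edges: "\<And>j. j \<in> colours k \<Longrightarrow> size (edges (colour_class H c j)) \<le> r * n div h"
    and few_comps: "\<And>j. j \<in> colours k \<Longrightarrow> num_components (colour_class H c j) + m + r * n div h \<le>
      r * m + size (edges (colour_class H c j)) + 1"
  shows "\<exists>d. connected_factorization r k G d \<and> extends_colouring V d c"
proof -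
  define J where "J = colours k"
  define F where "F = colour_class H c"
  \<comment> \<open>The number of pure edges, those concentrated on the amalgamated vertex, that
    bring colour \<open>j\<close> up to rn/h edges. In \<open>c'\<close> they are the pairs with
    empty trace, which \<open>c\<close> does not contain.\<close>
  define b where "b = (\<lambda>j. r * n div h - size (edges (F j)))"
  define c' where "c' = c + (\<Sum>j\<in>J. replicate_mset (b j) ({}, j))"
  have finJ: "finite J" using finite_colours by (simp add: J_def)
  obtain I :: "nat set" and g where I: "finite I" "c' = image_mset g (mset_set I)"
    by (rule mset_as_image)
  define A where "A = (\<lambda>i. fst (g i))"
  define col where "col = (\<lambda>i. snd (g i))"
  define C where "C = (\<lambda>j. {i \<in> I. col i = j})"
  have finC: "finite (C j)" for j using I by (simp add: C_def)
  have hrn: "h dvd r * n" using adm by (simp add: admissible_def)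

  have vF: "verts (F j) = X - V" for j by (simp add: F_def colour_class_def verts_H)
  have F_mem: "e \<noteq> {}" "e \<subseteq> X - V" "card e \<le> h" if "e \<in># edges (F j)" for e j
    using mem_class_H mem_edges_H that unfolding F_def by blast+
  have c_mem: "fst x \<noteq> {}" "fst x \<subseteq> X - V" "card (fst x) \<le> h" "snd x \<in> J" if "x \<in># c" for x
    using fst_c_mem[OF that] snd_c[OF that] mem_edges_H by (auto simp: J_def)
  have set_pure: "x \<in># (\<Sum>j\<in>J. replicate_mset (b j) ({}, j)) \<Longrightarrow> fst x = {} \<and> snd x \<in> J" for x
    using finJ by (auto simp: set_mset_sum split: if_splits)
  have c'_mem: "x \<in># c \<or> fst x = {} \<and> snd x \<in> J" if "x \<in># c'" for x
    using that set_pure[of x] unfolding c'_def by fastforce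
  have g_c': "g i \<in># c'" if "i \<in> I" for i using that I by simp
  have A: "A i \<subseteq> X - V" "card (A i) \<le> h" and col: "col i \<in> J" if "i \<in> I" for i
    using c'_mem[OF g_c'[OF that]] c_mem[of "g i"] by (auto simp: A_def col_def)
  have finA: "finite (A i)" if "i \<in> I" for i
    using A[OF that] finX finite_subset[of "A i" X] by auto

  have c_idx: "c = image_mset g (mset_set {i \<in> I. A i \<noteq> {}})"
  proof -
    have "image_mset g (mset_set {i \<in> I. A i \<noteq> {}}) = filter_mset (\<lambda>x. fst x \<noteq> {}) c'"
      using I by (simp add: filter_image_mset_set A_def)
    also have "\<dots> = c"
    proof -
      have "filter_mset (\<lambda>x. fst x \<noteq> {}) c = c" using c_mem by (simp add: filter_mset_eq_conv)
      moreover have "filter_mset (\<lambda>x. fst x \<noteq> {}) (\<Sum>j\<in>J. replicate_mset (b j) ({}, j)) = {#}"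
        using set_pure by fastforce
      ultimately show ?thesis by (simp add: c'_def)
    qed
    finally show ?thesis by simp
  qed
  have edgesF: "edges (F j) = image_mset A (mset_set {i \<in> C j. A i \<noteq> {}})" for j
  proof -
    have "{i \<in> {i \<in> I. A i \<noteq> {}}. snd (g i) = j} = {i \<in> C j. A i \<noteq> {}}"
      by (auto simp: C_def col_def)
    moreover have "fst \<circ> g = A" by (simp add: A_def comp_def)
    ultimately show ?thesis using I
      by (subst F_def) (simp add: colour_class_def c_idx filter_image_mset_set image_mset.compositionality)
  qed
  have pure: "card {i \<in> C j. A i = {}} = b j" if j: "j \<in> J" for j
  proof -
    have "{i \<in> C j. A i = {}} = {i \<in> I. g i = ({}, j)}"
      by (auto simp: C_def A_def col_def prod_eq_iff)
    also have "card \<dots> = count c' ({}, j)"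
      using I by (simp add: count_image_mset_set)
    also have "\<dots> = b j"
    proof -
      have "count c ({}, j) = 0" using c_mem(1)[of "({}, j)"] by (auto simp: not_in_iff[symmetric])
      moreover have "(\<Sum>j'\<in>J. count (replicate_mset (b j') ({} :: 'a set, j')) ({}, j)) =
          (\<Sum>j'\<in>J. if j' = j then b j else 0)" by (intro sum.cong) auto
      ultimately show ?thesis using finJ j by (simp add: c'_def count_sum)
    qed
    finally show ?thesis .
  qed
  have sizeF: "size (edges (F j)) = card {i \<in> C j. A i \<noteq> {}}" for j by (simp add: edgesF)
  have cardC: "card (C j) = r * n div h" if j: "j \<in> J" for j
  proof -
    have "C j = {i \<in> C j. A i \<noteq> {}} \<union> {i \<in> C j. A i = {}}" by auto
    then have "card (C j) = card {i \<in> C j. A i \<noteq> {}} + card {i \<in> C j. A i = {}}"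
      using finC by (subst card_Un_disjoint[symmetric]) auto
    then show ?thesis using pure[OF j] few_edges[of j] j by (simp add: sizeF[symmetric] b_def J_def F_def)
  qed

  \<comment> \<open>Divisibility makes the real number \<open>k\<close> an integer q, so the colours
    are exactly 1, ..., q.\<close>
  have deg_split: "lam * ((n - 1) choose (h - 1)) = card J * r"
  proof -
    obtain q where q: "lam * ((n - 1) choose (h - 1)) = r * q" using adm by (auto simp: admissible_def)
    then have "real lam * real ((n - 1) choose (h - 1)) = real r * real q" by (metis of_nat_mult)
    then have "k = real q" using pos by (simp add: k_eq field_simps)
    then have "J = {1..q}" by (auto simp: J_def colours_def)
    then show ?thesis using q by simp
  qed
  \<comment> \<open>With rn/h edges in each of k colours, h|I| = krn = \<lambda> n C(n-1,h-1) =
    \<lambda> h C(n,h). By \<open>size_c\<close> exactly \<lambda> C(m,h) of the edges are pure, as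
    the empty trace requires.\<close>
  have total_I: "card I = lam * (n choose h)"
  proof -
    have "card I = (\<Sum>j\<in>J. card {i \<in> I. col i = j})"
    proof -
      have "col ` I \<subseteq> J" using col by auto
      then show ?thesis using sum.group[OF I(1) finJ, of col "\<lambda>_. 1::nat"] by simp
    qed
    also have "\<dots> = card J * (r * n div h)" using cardC by (simp add: C_def)
    finally have "h * card I = card J * r * n" using hrn by (simp add: mult.left_commute mult.assoc)
    also have "\<dots> = lam * (h * (n choose h))"
      using deg_split times_binomial_minus1_eq[OF pos(3), of n] by (simp add: mult.assoc mult.commute)
    finally have "h * card I = h * (lam * (n choose h))" by (simp add: mult.left_commute)
    then show ?thesis using pos by simp
  qed
  have size_idx: "size {#x \<in># c. P x#} = card {i \<in> I. A i \<noteq> {} \<and> P (g i)}" for P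
    using I by (subst c_idx) (simp add: filter_image_mset_set conj_assoc)
  have types: "card {i \<in> I. A i = B} = lam * (m choose (h - card B))"
    if B: "B \<subseteq> X - V" "card B \<le> h" for B
  proof (cases "B = {}")
    case True
    have "I = {i \<in> I. A i \<noteq> {}} \<union> {i \<in> I. A i = {}}" by auto
    then have "card I = card {i \<in> I. A i \<noteq> {}} + card {i \<in> I. A i = {}}"
      using I by (subst card_Un_disjoint[symmetric]) auto
    moreover have "size c = card {i \<in> I. A i \<noteq> {}}" using size_idx[of "\<lambda>_. True"] by simp
    ultimately show ?thesis using True size_c total_I by simp
  next
    case False
    then have "{i \<in> I. A i = B} = {i \<in> I. A i \<noteq> {} \<and> fst (g i) = B}" by (auto simp: A_def)
    then show ?thesis using count_c[OF B(1) False B(2)] size_idx[of "\<lambda>x. fst x = B"] by simp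
  qed

  interpret detachment I col J X h r lam
    by unfold_locales (use I finX col pos in auto)

  define L where "L = (\<lambda>j. linked (F j))"
  \<comment> \<open>A pure edge is labelled by its own index. For any other edge the image of the
    whole trace avoids choosing a vertex; it is the class of each vertex of the trace.\<close>
  define l where "l = (\<lambda>i. if A i = {} then Inr i else Inl (L (col i) `` A i))"
  have L_class: "L j `` A i = L j `` {v}" if "i \<in> C j" "v \<in> A i" for i j v
  proof -
    have "A i \<in># edges (F j)" using that finC by (auto simp: edgesF)
    then have "L j `` {w} = L j `` {v}" if "w \<in> A i" for w
      using that \<open>v \<in> A i\<close> F_mem(2)[of "A i" j] linked_edge[of "A i" "F j" w v] vF
        equiv_class_eq[OF equiv_linked] by (simp add: L_def)
    then show ?thesis using that by blast
  qed
  \<comment> \<open>Turns a path of vertices into a sequence of successively meeting edges.\<close>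
  have reach: "\<exists>i'\<in>C j. (i, i') \<in> (meet A j)\<^sup>* \<and> w \<in> A i'"
    if "(v, w) \<in> (adj (F j))\<^sup>*" "i \<in> C j" "v \<in> A i" for i v w j
    using that
  proof (induction rule: rtrancl_induct)
    case (step y z)
    then obtain i' where i': "i' \<in> C j" "(i, i') \<in> (meet A j)\<^sup>*" "y \<in> A i'" by blast
    obtain i'' where i'': "i'' \<in> C j" "y \<in> A i''" "z \<in> A i''"
      using step.hyps(2) finC by (auto simp: edgesF)
    have "(i', i'') \<in> meet A j" using i' i'' by (auto simp: meet_def C_def)
    then show ?case using i' i'' by (meson rtrancl_into_rtrancl)
  qed auto

  have "amalgam V A l"
    unfolding amalgam_def
  proof (intro conjI ballI allI impI)
    show "V \<subseteq> X" by (rule VX)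
    show "A e \<subseteq> X - V" "card (A e) \<le> h" if "e \<in> I" for e using A[OF that] .
    show "card {e \<in> I. A e = B} = lam * (card V choose (h - card B))"
      if "B \<subseteq> X - V" "card B \<le> h" for B
      using types[OF that] cardV by simp
  next
    fix j assume j: "j \<in> J"
    have "(\<Sum>e\<in>C j. h - card (A e)) + (\<Sum>e\<in>C j. card (A e)) = card (C j) * h"
      using A(2) by (simp add: sum.distrib[symmetric] C_def)
    also have "\<dots> = r * n" using cardC[OF j] hrn by simp
    also have "(\<Sum>e\<in>C j. card (A e)) = (\<Sum>e\<in>{e \<in> C j. A e \<noteq> {}}. card (A e))"
      using finC by (intro sum.mono_neutral_right) auto
    also have "\<dots> = (\<Sum>e\<in>#edges (F j). card e)"
      by (simp add: edgesF image_mset.compositionality comp_def sum_unfold_sum_mset)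
    also have "\<dots> = r * (n - m)" using class_sizes(1) reg j by (simp add: F_def J_def)
    finally have "(\<Sum>e\<in>C j. h - card (A e)) + r * (n - m) = r * m + r * (n - m)"
      using nm by (simp add: distrib_left[symmetric])
    then show "(\<Sum>e\<in>{e \<in> I. col e = j}. h - card (A e)) = r * card V" by (simp add: C_def cardV)
  next
    fix j v assume j: "j \<in> J" and v: "v \<in> X - V"
    have "degree (F j) v = card {i \<in> {i \<in> C j. A i \<noteq> {}}. v \<in> A i}"
      using finC by (simp add: degree_def edgesF filter_image_mset_set)
    also have "{i \<in> {i \<in> C j. A i \<noteq> {}}. v \<in> A i} = {e \<in> I. col e = j \<and> v \<in> A e}" by (auto simp: C_def)
    finally show "card {e \<in> I. col e = j \<and> v \<in> A e} = r"
      using reg[of j] j v vF[of j] by (simp add: regular_def F_def J_def)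
  next
    fix j assume j: "j \<in> J"
    have "l ` C j \<subseteq> Inl ` ((X - V) // L j) \<union> Inr ` {i \<in> C j. A i = {}}"
    proof (rule image_subsetI)
      fix i assume i: "i \<in> C j"
      show "l i \<in> Inl ` ((X - V) // L j) \<union> Inr ` {i \<in> C j. A i = {}}"
      proof (cases "A i = {}")
        case False
        then obtain v where v: "v \<in> A i" by auto
        then have "l i = Inl (L j `` {v})" using i L_class[OF i v] False by (auto simp: l_def C_def)
        moreover have "v \<in> X - V" using i v A by (auto simp: C_def)
        ultimately show ?thesis by (auto intro: quotientI)
      qed (use i in \<open>auto simp: l_def\<close>)
    qed
    then have "card (l ` C j) \<le> card (Inl ` ((X - V) // L j) \<union> Inr ` {i \<in> C j. A i = {}} :: ('a set + nat) set)"
      using finC finX by (intro card_mono) (auto simp: quotient_def)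
    also have "\<dots> \<le> card ((X - V) // L j) + card {i \<in> C j. A i = {}}"
      by (rule order.trans[OF card_Un_le]) (simp add: card_image)
    also have "\<dots> = num_components (F j) + b j"
      using pure[OF j] by (simp add: num_components_eq vF L_def)
    also have "\<dots> \<le> (r - 1) * m + 1"
    proof -
      have "num_components (F j) + m + r * n div h \<le> r * m + size (edges (F j)) + 1"
        using few_comps j by (simp add: F_def J_def)
      moreover have "size (edges (F j)) \<le> r * n div h" using few_edges j by (simp add: F_def J_def)
      moreover have "r * m = (r - 1) * m + m" using pos(4) by (cases r) auto
      ultimately show ?thesis unfolding b_def by linarith
    qed
    finally show "card (l ` {e \<in> I. col e = j}) \<le> (r - 1) * card V + 1" by (simp add: C_def cardV)
  next
    fix e f assume ef: "e \<in> I" "f \<in> I" "col e = col f" "l e = l f"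
    define j where "j = col e"
    have C: "e \<in> C j" "f \<in> C j" using ef by (auto simp: C_def j_def)
    show "(e, f) \<in> (meet A (col e))\<^sup>*"
    proof (cases "A e = {}")
      case True
      then show ?thesis using ef by (auto simp: l_def split: if_splits)
    next
      case False
      then have "A f \<noteq> {}" "L j `` A e = L j `` A f" using ef by (auto simp: l_def j_def split: if_splits)
      then obtain v w where vw: "v \<in> A e" "w \<in> A f" using False by auto
      then have "L j `` {v} = L j `` {w}" using L_class C \<open>L j `` A e = L j `` A f\<close> by metis
      moreover have "w \<in> X - V" using vw A ef by auto
      ultimately have "(v, w) \<in> L j"
        using eq_equiv_class[OF _ equiv_linked, of "F j" v w] by (simp add: L_def vF)
      then have "(v, w) \<in> (adj (F j))\<^sup>*" by (simp add: L_def linked_def)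
      then obtain i' where i': "i' \<in> C j" "(e, i') \<in> (meet A j)\<^sup>*" "w \<in> A i'"
        using reach C vw by blast
      then have "(i', f) \<in> meet A j" using C vw by (auto simp: meet_def C_def)
      then show ?thesis using i' by (simp add: j_def)
    qed
  next
    fix e assume e: "e \<in> I"
    define j where "j = col e"
    have C: "e \<in> C j" and j: "j \<in> J" using e col by (auto simp: C_def j_def)
    show "\<exists>f\<in>I. col f = col e \<and> l f = l e \<and> card (A f) < h"
    proof (cases "A e = {}")
      case True
      then show ?thesis using e pos by (intro bexI[of _ e]) auto
    next
      case False
      then obtain v where v: "v \<in> A e" by auto
      then have vX: "v \<in> X - V" using A e by auto
      define Q where "Q = L j `` {v}"
      have "Q \<in> (X - V) // L j" using vX by (auto simp: Q_def intro: quotientI)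
      then have "\<lparr>verts = Q, edges = {#e \<in># edges (F j). e \<subseteq> Q#}\<rparr> \<in> components (F j)"
        by (auto simp: components_def vF L_def)
      \<comment> \<open>Condition (iv) provides an edge of size below \<open>h\<close> in the
        component of \<open>e\<close>, and such an edge meets the amalgamated vertex.\<close>
      then have "\<not> uniform h \<lparr>verts = Q, edges = {#e \<in># edges (F j). e \<subseteq> Q#}\<rparr>"
        using nunif j by (simp add: F_def J_def)
      then obtain e' where e': "e' \<in># edges (F j)" "e' \<subseteq> Q" "card e' \<noteq> h" by (auto simp: uniform_def)
      then obtain f where f: "f \<in> C j" "A f = e'" "A f \<noteq> {}" using finC by (auto simp: edgesF)
      then obtain w where w: "w \<in> A f" by auto
      then have "(v, w) \<in> L j" using e' f by (auto simp: Q_def)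
      then have "L j `` {v} = L j `` {w}"
        using equiv_class_eq[OF equiv_linked] by (simp add: L_def)
      then have "L j `` A f = L j `` A e" using L_class f(1) w C v by metis
      then have "l f = l e" "col f = col e" using f False by (auto simp: l_def C_def j_def)
      moreover have "f \<in> I" using f by (simp add: C_def)
      moreover have "card (A f) < h" using e' f A(2)[OF \<open>f \<in> I\<close>] by simp
      ultimately show ?thesis by blast
    qed
  qed
  then obtain A' and l' :: "nat \<Rightarrow> 'a set + nat" where am: "amalgam {} A' l'"
    and A'V: "\<forall>i\<in>I. A' i - V = A i"
    using detach_all by blast

  define d where "d = image_mset (\<lambda>i. (A' i, col i)) (mset_set I)"
  have A': "A' i \<subseteq> X" "card (A' i) = h" if "i \<in> I" for i
  proof -
    show "A' i \<subseteq> X" using amalgamD(2)[OF am that] by simp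
    show "card (A' i) = h" using amalgam_mult_le[OF am that] amalgamD(3)[OF am that] by simp
  qed
  have fst_d: "image_mset fst d = edges G"
  proof (rule multiset_eqI)
    fix B
    have cnt: "count (image_mset fst d) B = card {i \<in> I. A' i = B}"
      using I by (simp add: d_def image_mset.compositionality comp_def count_image_mset_set)
    have "count (edges G) B = size {#e \<in># edges G. e = B#}" by (simp add: count_conv_size_mset eq_commute)
    also have "\<dots> = lam * card {e. e \<subseteq> X \<and> card e = h \<and> e = B}" by (rule size_filter_edges_G)
    finally have cntG: "count (edges G) B = lam * card {e. e \<subseteq> X \<and> card e = h \<and> e = B}" .
    show "count (image_mset fst d) B = count (edges G) B"
    proof (cases "B \<subseteq> X \<and> card B = h")
      case True
      then have "{e. e \<subseteq> X \<and> card e = h \<and> e = B} = {B}" by auto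
      \<comment> \<open>The binomial is 0 choose 0, so each edge occurs exactly \<lambda>
        times.\<close>
      then show ?thesis using True amalgamD(4)[OF am, of B] by (simp add: cnt cntG)
    next
      case False
      then have none: "{i \<in> I. A' i = B} = {}" "{e. e \<subseteq> X \<and> card e = h \<and> e = B} = {}" using A' by auto
      show ?thesis unfolding cnt cntG none by simp
    qed
  qed
  have classG: "edges (colour_class G d j) = image_mset A' (mset_set (C j))" for j
    using I by (simp add: colour_class_def d_def filter_image_mset_set image_mset.compositionality comp_def C_def)
  have vG: "verts (colour_class G d j) = X" for j by (simp add: colour_class_def verts_G)
  have degG: "card {i \<in> C j. v \<in> A' i} = r" if "j \<in> J" "v \<in> X" for j v
  proof -
    have "{i \<in> C j. v \<in> A' i} = {e \<in> I. col e = j \<and> v \<in> A' e}" by (auto simp: C_def)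
    then show ?thesis using amalgamD(6)[OF am that(1), of v] that by simp
  qed
  have "connected_factorization r k G d"
    unfolding connected_factorization_def edge_colouring_def
  proof (intro conjI ballI)
    show "image_mset fst d = edges G" by (rule fst_d)
    show "snd x \<in> colours k" if "x \<in># d" for x using that I col by (auto simp: d_def J_def)
  next
    fix j assume "j \<in> colours k"
    then have j: "j \<in> J" by (simp add: J_def)
    have "edges (colour_class G d j) \<subseteq># edges G"
      unfolding fst_d[symmetric] by (simp add: colour_class_def image_mset_subseteq_mono)
    moreover have "degree (colour_class G d j) v = r" if "v \<in> X" for v
      using degG[OF j that] finC by (simp add: degree_def classG filter_image_mset_set)
    ultimately show "is_factor r (colour_class G d j) G"
      by (simp add: is_factor_def regular_def vG verts_G)
    have "(u, v) \<in> (adj (colour_class G d j))\<^sup>*" if uv: "u \<in> X" "v \<in> X" for u v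
    proof -
      have "card {i \<in> C j. u \<in> A' i} \<noteq> 0" "card {i \<in> C j. v \<in> A' i} \<noteq> 0"
        using degG[OF j uv(1)] degG[OF j uv(2)] pos(4) by auto
      then have "{i \<in> C j. u \<in> A' i} \<noteq> {}" "{i \<in> C j. v \<in> A' i} \<noteq> {}" by (metis card.empty)+
      then obtain i i' where i: "i \<in> C j" "u \<in> A' i" "i' \<in> C j" "v \<in> A' i'" by blast
      \<comment> \<open>With no vertex amalgamated, the bound on the labels of a colour is
        1.\<close>
      have "card (l' ` C j) \<le> 1" using amalgamD(7)[OF am j] by (simp add: C_def)
      then have "\<forall>y\<in>l' ` C j. \<forall>z\<in>l' ` C j. y = z"
        unfolding One_nat_def card_le_Suc0_iff_eq[OF finite_imageI[OF finC]] .
      then have "l' i = l' i'" using i by blast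
      moreover have "col i = j" "col i' = j" "i \<in> I" "i' \<in> I" using i by (auto simp: C_def)
      ultimately have "(i, i') \<in> (meet A' j)\<^sup>*" using amalgamD(8)[OF am, of i i'] by simp
      then have "\<forall>w\<in>A' i'. (u, w) \<in> (adj (colour_class G d j))\<^sup>*"
      proof (induction rule: rtrancl_induct)
        case base
        then show ?case using i finC by (auto simp: classG intro!: r_into_rtrancl)
      next
        case (step y z)
        then obtain x where x: "x \<in> A' y" "x \<in> A' z" "z \<in> C j" by (auto simp: meet_def C_def)
        show ?case
        proof
          fix w assume "w \<in> A' z"
          then have "(x, w) \<in> adj (colour_class G d j)" using x finC by (auto simp: classG)
          then show "(u, w) \<in> (adj (colour_class G d j))\<^sup>*"
            using step.IH x(1) by (meson rtrancl_into_rtrancl)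
        qed
      qed
      then show ?thesis using i by blast
    qed
    moreover have "X \<noteq> {}" using cardX pos by auto
    ultimately show "connected_hypergraph (colour_class G d j)"
      by (simp add: connected_hypergraph_iff vG)
  qed
  moreover have "extends_colouring V d c"
  proof -
    have "\<not> A' i \<subseteq> V \<longleftrightarrow> A i \<noteq> {}" if "i \<in> I" for i using A'V that by auto
    then have *: "{i \<in> I. \<not> A' i \<subseteq> V} = {i \<in> I. A i \<noteq> {}}" by auto
    have "image_mset (\<lambda>(e, j). (e - V, j)) {#(e, j) \<in># d. \<not> e \<subseteq> V#} =
        image_mset (\<lambda>i. (A' i - V, col i)) (mset_set {i \<in> I. \<not> A' i \<subseteq> V})"
      using I by (simp add: d_def filter_image_mset_set image_mset.compositionality comp_def)
    also have "\<dots> = image_mset g (mset_set {i \<in> I. A i \<noteq> {}})"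
      unfolding * using A'V I by (intro image_mset_cong) (auto simp: A_def col_def)
    finally show ?thesis by (simp add: extends_colouring_def c_idx)
  qed
  ultimately show ?thesis by blast
qed

end

theorem theorem7p12:
  fixes n m h r lam :: nat
    and k :: real
    and X V :: "'a set"
    and G H :: "'a hypergraph"
    and c :: "('a set \<times> nat) multiset"
  assumes "n > 0" "m > 0" "h > 0" "r > 0" "lam > 0"
    and "n > m" "m > h"
    and "finite X" "card X = n"
    and "G = complete_hypergraph lam h X"
    and "V \<subseteq> verts G" "card V = m"
    and "H = delete_vertices G V"
    and "k = real lam / real r * real ((n - 1) choose (h - 1))"
    and "partial_factorization r k H c"
  shows "(\<exists>d. connected_factorization r k G d \<and> extends_colouring V d c) \<longleftrightarrow>
     admissible h n r lam \<and>
     r \<ge> 2 \<and>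
     (\<forall>j \<in> colours k. regular r (colour_class H c j)) \<and>
     (\<forall>j \<in> colours k. \<forall>K \<in> components (colour_class H c j). \<not> uniform h K) \<and>
     (\<forall>j \<in> colours k. real (size (edges (colour_class H c j))) \<le> real r * real n / real h) \<and>
     (\<forall>j \<in> colours k.
        real (num_components (colour_class H c j)) \<le>
          real r * real n * (1 - 1 / real h)
          - (\<Sum>i = 1..h - 1. real i * real (num_edges_of_size (colour_class H c j) (i + 1)))
          - real m + 1)"
proof -
  interpret extension_problem n m h r lam k X V G H c
    by unfold_locales (use assms in auto)
  show ?thesis
  proof
    assume "\<exists>d. connected_factorization r k G d \<and> extends_colouring V d c"
    then obtain d where d: "connected_factorization r k G d" "extends_colouring V d c" by blast
    note nec = necessity[OF d]
    have "h dvd r * n" using nec(1) by (simp add: admissible_def)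
    then show "admissible h n r lam \<and> r \<ge> 2 \<and>
     (\<forall>j \<in> colours k. regular r (colour_class H c j)) \<and>
     (\<forall>j \<in> colours k. \<forall>K \<in> components (colour_class H c j). \<not> uniform h K) \<and>
     (\<forall>j \<in> colours k. real (size (edges (colour_class H c j))) \<le> real r * real n / real h) \<and>
     (\<forall>j \<in> colours k.
        real (num_components (colour_class H c j)) \<le>
          real r * real n * (1 - 1 / real h)
          - (\<Sum>i = 1..h - 1. real i * real (num_edges_of_size (colour_class H c j) (i + 1)))
          - real m + 1)"
      using nec component_bound_iff edge_bound_iff by blast
  next
    assume rhs: "admissible h n r lam \<and> r \<ge> 2 \<and>
     (\<forall>j \<in> colours k. regular r (colour_class H c j)) \<and>
     (\<forall>j \<in> colours k. \<forall>K \<in> components (colour_class H c j). \<not> uniform h K) \<and>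
     (\<forall>j \<in> colours k. real (size (edges (colour_class H c j))) \<le> real r * real n / real h) \<and>
     (\<forall>j \<in> colours k.
        real (num_components (colour_class H c j)) \<le>
          real r * real n * (1 - 1 / real h)
          - (\<Sum>i = 1..h - 1. real i * real (num_edges_of_size (colour_class H c j) (i + 1)))
          - real m + 1)"
    then have "h dvd r * n" by (simp add: admissible_def)
    with rhs show "\<exists>d. connected_factorization r k G d \<and> extends_colouring V d c"
      using component_bound_iff edge_bound_iff by (intro sufficiency) blast+
  qed
qed

end
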